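(* The total area of the disks tangent to the great circle in the Apollonian Window (i.e. of the corona of its disk of curvature $-1$) is $$A=\frac{\pi}{2}\sum_{\substack{m,n\in\mathbb Z\\ \gcd(m,n)=1}}\frac{1}{\big(m^2+n^2+1\big)^2},$$ where $(m,n)$ runs over all pairs of coprime integers (including negative ones).
   Context: The Apollonian Window is the Apollonian disk packing generated by the exterior of the unit circle centered at the origin (regarded as a disk of curvature $-1$; the unit circle is the "great circle") and the two disks of radius $1/2$ centered at $(\pm\frac12,0)$: starting from these three mutually tangent disks (disjoint interiors, tangent boundaries), one repeatedly adjoins, for every three mutually tangent disks already present, both disks that are tangent to all three. The corona of a disk in the packing is the set of all disks of the packing tangent to it; the corona of the exterior disk consists of the disks of the packing touching the unit circle from inside. The pairs $(\pm1,0)$ and $(0,\pm1)$ are coprime. *)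

theory Defs
  imports "HOL-Analysis.Analysis"
begin

text \<open>
  Disks are closed disks of the Riemann sphere, given by their finite parts in the complex plane:
  ordinary disks (positive curvature), exteriors of circles (negative curvature), and
  half-planes (curvature zero).
\<close>

definition is_disk :: "complex set \<Rightarrow> bool" where
  "is_disk D \<longleftrightarrow>
     (\<exists>c r. r > 0 \<and> D = cball c r) \<or>
     (\<exists>c r. r > 0 \<and> D = - ball c r) \<or>
     (\<exists>a b. a \<noteq> 0 \<and> D = {z. a \<bullet> z \<le> b})"

text \<open>
  The boundary in the Riemann sphere, with \<^const>\<open>None\<close> as the point at infinity;
  a boundary line passes through that point.
\<close>

definition disk_boundary :: "complex set \<Rightarrow> complex option set" where
  "disk_boundary D = Some ` frontier D \<union> (if bounded (frontier D) then {} else {None})"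

text \<open>
  Two distinct circles of the Riemann sphere are tangent iff they have exactly one common point;
  for two lines this is the point at infinity.
\<close>

definition tangent :: "complex set \<Rightarrow> complex set \<Rightarrow> bool" where
  "tangent D E \<longleftrightarrow>
     interior D \<inter> interior E = {} \<and> (\<exists>!p. p \<in> disk_boundary D \<inter> disk_boundary E)"

inductive_set apollonian_packing :: "complex set set \<Rightarrow> complex set set"
  for S :: "complex set set" where
  seed: "D \<in> S \<Longrightarrow> D \<in> apollonian_packing S"
| adjoin: "\<lbrakk>D1 \<in> apollonian_packing S; D2 \<in> apollonian_packing S; D3 \<in> apollonian_packing S;
     tangent D1 D2; tangent D1 D3; tangent D2 D3;
     is_disk D; tangent D D1; tangent D D2; tangent D D3\<rbrakk>
     \<Longrightarrow> D \<in> apollonian_packing S"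

definition great_disk :: "complex set" where
  "great_disk = - ball 0 1"

definition apollonian_window :: "complex set set" where
  "apollonian_window =
     apollonian_packing {great_disk, cball (1/2) (1/2), cball (-1/2) (1/2)}"

definition corona :: "complex set set \<Rightarrow> complex set \<Rightarrow> complex set set" where
  "corona P D = {E \<in> P. tangent D E}"

end

(*
Encode a disk with centre (x + iy)/(f - e) and curvature f - e as the vector (e, x, y, f) of
Lorentzian norm 1; two such disks are tangent iff the inner product of their vectors is -1, and the
exterior of the unit circle is (1, 0, 0, 0).  Given three mutually tangent vectors, the fourth ones
are u + v + w plus or minus a cross product, so all disks of the window lie in the set of integer
vectors with e odd, y even and x + f even.  Inner products in that set are odd, hence never in
(-1, 1): its disks are disjoint, tangent or nested, and their boundaries never cross.  Therefore
"being the exterior disk, or maximal among the lattice disks properly inside the unit disk" passes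
from three mutually tangent disks to each disk tangent to all of them.

A lattice disk touching the unit circle from inside has e = -1 and x^2 + y^2 = f^2, so that
x + iy = k (m + in)^2 with m, n coprime and k > 0; it lies inside the disk with k = 1, so maximality
forces k = 1.  Conversely the disks of two vectors (m, n), (p, q) of determinant 1 or -1 are
tangent, and adjoining gives the disk of their sum and difference; Euclid's algorithm reaches all
coprime pairs.  The disk of (m, n) has radius 1/(m^2 + n^2 + 1) and determines (m, n) up to sign.
*)
theory Submission
  imports Defs "HOL-Computational_Algebra.Nth_Powers"
begin

section \<open>The Lorentz form and the fourth tangent disk\<close>

definition det3 ::
  "'a::comm_ring_1 \<times> 'a \<times> 'a \<Rightarrow> 'a \<times> 'a \<times> 'a \<Rightarrow> 'a \<times> 'a \<times> 'a \<Rightarrow> 'a" where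
  "det3 = (\<lambda>(a1,a2,a3) (b1,b2,b3) (c1,c2,c3).
     a1 * (b2*c3 - b3*c2) - a2 * (b1*c3 - b3*c1) + a3 * (b1*c2 - b2*c1))"

lemma of_int_det3:
  "det3 (of_int a1, of_int a2, of_int a3) (of_int b1, of_int b2, of_int b3)
     (of_int c1, of_int c2, of_int c3) = of_int (det3 (a1,a2,a3) (b1,b2,b3) (c1,c2,c3))"
  by (simp add: det3_def)

type_synonym quad = "real \<times> real \<times> real \<times> real"

fun lor :: "quad \<Rightarrow> quad \<Rightarrow> real" where
  "lor (e, x, y, f) (e', x', y', f') = e*e' + x*x' + y*y' - f*f'"

text \<open>
  The Lorentzian dual of \<open>d \<mapsto> det (u, v, w, d)\<close>, up to sign; the last coordinate carries
  the sign of the form.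
\<close>

fun lcross :: "quad \<Rightarrow> quad \<Rightarrow> quad \<Rightarrow> quad" where
  "lcross (e1, x1, y1, f1) (e2, x2, y2, f2) (e3, x3, y3, f3) =
     (det3 (x1,y1,f1) (x2,y2,f2) (x3,y3,f3), - det3 (e1,y1,f1) (e2,y2,f2) (e3,y3,f3),
      det3 (e1,x1,f1) (e2,x2,f2) (e3,x3,f3), det3 (e1,x1,y1) (e2,x2,y2) (e3,x3,y3))"

lemma lor_commute: "lor u v = lor v u"
  by (cases u; cases v) simp

lemma lor_add_left: "lor (u + v) w = lor u w + lor v w"
  by (cases u; cases v; cases w) (simp add: algebra_simps)

lemma lor_diff_left: "lor (u - v) w = lor u w - lor v w"
  by (cases u; cases v; cases w) (simp add: algebra_simps)

lemma lor_scaleR_left: "lor (a *\<^sub>R u) w = a * lor u w"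
  by (cases u; cases w) (simp add: algebra_simps)

lemma lor_add_right: "lor w (u + v) = lor w u + lor w v"
  by (cases u; cases v; cases w) (simp add: algebra_simps)

lemma lor_diff_right: "lor w (u - v) = lor w u - lor w v"
  by (cases u; cases v; cases w) (simp add: algebra_simps)

lemma lor_scaleR_right: "lor w (a *\<^sub>R u) = a * lor w u"
  by (cases u; cases w) (simp add: algebra_simps)

lemmas lor_linear = lor_add_left lor_diff_left lor_scaleR_left
  lor_add_right lor_diff_right lor_scaleR_right

lemma lor_lcross_lcross:
  "lor (lcross u v w) (lcross u v w) =
     - det3 (lor u u, lor u v, lor u w) (lor v u, lor v v, lor v w) (lor w u, lor w v, lor w w)"
proof -
  \<comment> \<open>With \<open>B\<close> the bivector \<open>v \<and> w\<close>, this is \<open>|u \<and> B|\<^sup>2 = |u|\<^sup>2 |B|\<^sup>2 - |z|\<^sup>2\<close>, where \<open>z\<close> is the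
    contraction of \<open>B\<close> by \<open>u\<close>. Passing through the minors of \<open>B\<close> keeps the expansions small.\<close>
  obtain e x y f where u: "u = (e,x,y,f)" by (cases u) auto
  obtain e2 x2 y2 f2 where v: "v = (e2,x2,y2,f2)" by (cases v) auto
  obtain e3 x3 y3 f3 where w: "w = (e3,x3,y3,f3)" by (cases w) auto
  define ex ey ef xy xf yf where "ex = e2*x3 - x2*e3" and "ey = e2*y3 - y2*e3" and "ef = e2*f3 - f2*e3"
    and "xy = x2*y3 - y2*x3" and "xf = x2*f3 - f2*x3" and "yf = y2*f3 - f2*y3"
  note minors = ex_def ey_def ef_def xy_def xf_def yf_def
  define z where "z = lor u v *\<^sub>R w - lor u w *\<^sub>R v"
  have gram: "det3 (lor u u, lor u v, lor u w) (lor v u, lor v v, lor v w) (lor w u, lor w v, lor w w) =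
      lor u u * (lor v v * lor w w - (lor v w)\<^sup>2) - lor z z"
    unfolding z_def by (simp add: det3_def lor_linear lor_commute power2_eq_square algebra_simps)
  have vw: "lor v v * lor w w - (lor v w)\<^sup>2 = ex\<^sup>2 + ey\<^sup>2 + xy\<^sup>2 - ef\<^sup>2 - xf\<^sup>2 - yf\<^sup>2"
    unfolding minors by (simp add: v w power2_eq_square algebra_simps)
  have z: "z = (- x*ex - y*ey + f*ef, e*ex - y*xy + f*xf, e*ey + x*xy + f*yf, e*ef + x*xf + y*yf)"
    unfolding z_def minors by (simp add: u v w algebra_simps)
  have cross: "lcross u v w = (x*yf - y*xf + f*xy, - (e*yf - y*ef + f*ey), e*xf - x*ef + f*ex, e*xy - x*ey + y*ex)"
    unfolding minors by (simp add: u v w det3_def algebra_simps)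
  show ?thesis
    unfolding gram vw z cross by (simp add: u power2_eq_square algebra_simps)
qed

lemma lor_scale_lcross:
  assumes "lor d u = 0" "lor d v = 0" "lor d w = 0"
  shows "lor (lcross u v w) (lcross u v w) *\<^sub>R d = lor d (lcross u v w) *\<^sub>R lcross u v w"
proof -
  obtain e x y f where d: "d = (e,x,y,f)" by (cases d) auto
  obtain e1 x1 y1 f1 where u: "u = (e1,x1,y1,f1)" by (cases u) auto
  obtain e2 x2 y2 f2 where v: "v = (e2,x2,y2,f2)" by (cases v) auto
  obtain e3 x3 y3 f3 where w: "w = (e3,x3,y3,f3)" by (cases w) auto
  obtain a b c h where n: "lcross u v w = (a,b,c,h)" by (cases "lcross u v w") auto
  note ns = n[unfolded u v w, symmetric, simplified, unfolded det3_def, simplified]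
  \<comment> \<open>The cofactors eliminate the two coordinates \<open>s\<close> and \<open>t\<close> from the three linear equations for \<open>d\<close>.\<close>
  have elim: "p = q"
    if "q - p = (sb*tc-sc*tb) * lor d u + (sc*ta-sa*tc) * lor d v + (sa*tb-sb*ta) * lor d w"
    for p q sa sb sc ta tb tc
    using that assms by simp
  have "e*b = x*a"
    by (rule elim[where sa=y1 and sb=y2 and sc=y3 and ta=f1 and tb=f2 and tc=f3])
      (simp add: ns d u v w algebra_simps)
  moreover have "y*a = e*c"
    by (rule elim[where sa=x1 and sb=x2 and sc=x3 and ta=f1 and tb=f2 and tc=f3])
      (simp add: ns d u v w algebra_simps)
  moreover have "f*a = e*h"
    by (rule elim[where sa=x1 and sb=x2 and sc=x3 and ta=y1 and tb=y2 and tc=y3])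
      (simp add: ns d u v w algebra_simps)
  moreover have "x*c = y*b"
    by (rule elim[where sa=e1 and sb=e2 and sc=e3 and ta=f1 and tb=f2 and tc=f3])
      (simp add: ns d u v w algebra_simps)
  moreover have "x*h = f*b"
    by (rule elim[where sa=e1 and sb=e2 and sc=e3 and ta=y1 and tb=y2 and tc=y3])
      (simp add: ns d u v w algebra_simps)
  moreover have "f*c = y*h"
    by (rule elim[where sa=e1 and sb=e2 and sc=e3 and ta=x1 and tb=x2 and tc=x3])
      (simp add: ns d u v w algebra_simps)
  ultimately have p: "e*b = x*a" "e*c = y*a" "e*h = f*a" "x*c = y*b" "x*h = f*b" "y*h = f*c"
    by auto
  show ?thesis unfolding n d using p by (auto; algebra)
qed

lemma descartes_fourth:
  assumes "lor u u = 1" "lor v v = 1" "lor w w = 1" "lor u v = -1" "lor u w = -1" "lor v w = -1"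
    and "lor d d = 1" "lor d u = -1" "lor d v = -1" "lor d w = -1"
  obtains \<sigma> where "\<sigma> = 1 \<or> \<sigma> = -1" "d = u + v + w + \<sigma> *\<^sub>R lcross u v w"
proof -
  define t where "t = d - (u + v + w)"
  define n where "n = lcross u v w"
  have r: "lor v u = -1" "lor w u = -1" "lor w v = -1" "lor u d = -1" "lor v d = -1" "lor w d = -1"
    using assms by (simp_all add: lor_commute)
  have t0: "lor t u = 0" "lor t v = 0" "lor t w = 0"
    by (simp_all add: t_def lor_linear assms r)
  have "lor t t = lor t d"
    using t0 by (subst (2) t_def) (simp add: lor_linear lor_commute[of t])
  also have "\<dots> = 4"
    by (simp add: t_def lor_linear assms r)
  finally have tt: "lor t t = 4" .
  have nn: "lor n n = 4"
    by (simp add: n_def lor_lcross_lcross assms r det3_def)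
  define L where "L = lor t n"
  have tn: "4 *\<^sub>R t = L *\<^sub>R n"
    using lor_scale_lcross[OF t0] nn by (simp add: n_def L_def)
  have "16 * lor t t = lor (4 *\<^sub>R t) (4 *\<^sub>R t)"
    by (simp add: lor_linear)
  also have "\<dots> = L^2 * 4"
    unfolding tn by (simp add: lor_linear nn power2_eq_square)
  finally have "L^2 = 4^2" using tt by simp
  then have "L / 4 = 1 \<or> L / 4 = -1" unfolding power2_eq_iff by auto
  moreover have "t = (1/4) *\<^sub>R (4 *\<^sub>R t)" by simp
  then have "t = (L/4) *\<^sub>R n" unfolding tn by simp
  then have "d = u + v + w + (L/4) *\<^sub>R n"
    by (simp add: t_def algebra_simps)
  ultimately show ?thesis using that unfolding n_def by blast
qed

definition unit_lattice :: "quad set" where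
  "unit_lattice = {(of_int e, of_int x, of_int y, of_int f) | e x y f :: int.
     odd e \<and> even y \<and> even (x + f) \<and> e^2 + x^2 + y^2 - f^2 = 1}"

lemma unit_lattice_lor: "v \<in> unit_lattice \<Longrightarrow> lor v v = 1"
proof (clarsimp simp: unit_lattice_def simp flip: power2_eq_square)
  fix e x y f :: int assume "e^2 + x^2 + y^2 - f^2 = 1"
  from arg_cong[OF this, of real_of_int]
  show "(real_of_int e)^2 + (real_of_int x)^2 + (real_of_int y)^2 - (real_of_int f)^2 = 1" by simp
qed

lemma lor_odd:
  assumes "u \<in> unit_lattice" "v \<in> unit_lattice"
  obtains k :: int where "odd k" "lor u v = of_int k"
proof -
  obtain e x y f where u: "u = (of_int e, of_int x, of_int y, of_int f)" "odd e" "even y" "even (x + f)"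
    using assms(1) by (auto simp: unit_lattice_def)
  obtain e' x' y' f' where v: "v = (of_int e', of_int x', of_int y', of_int f')" "odd e'" "even y'" "even (x' + f')"
    using assms(2) by (auto simp: unit_lattice_def)
  show ?thesis
    by (rule that[of "e*e' + x*x' + y*y' - f*f'"]) (use u v in auto)
qed

lemma lor_le_or_ge:
  assumes "u \<in> unit_lattice" "v \<in> unit_lattice"
  shows "lor u v \<le> -1 \<or> lor u v \<ge> 1"
proof -
  obtain k :: int where k: "odd k" "lor u v = of_int k"
    using lor_odd[OF assms] .
  then have "k \<le> -1 \<or> k \<ge> 1" by presburger
  then show ?thesis unfolding k(2) by linarith
qed

lemma descartes_lattice:
  assumes "u \<in> unit_lattice" "v \<in> unit_lattice" "w \<in> unit_lattice"
    and "lor u v = -1" "lor u w = -1" "lor v w = -1"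
    and "lor d d = 1" "lor d u = -1" "lor d v = -1" "lor d w = -1"
  shows "d \<in> unit_lattice"
proof -
  obtain \<sigma> where \<sigma>: "\<sigma> = 1 \<or> \<sigma> = -1" and d: "d = u + v + w + \<sigma> *\<^sub>R lcross u v w"
    by (rule descartes_fourth[OF assms(1-3)[THEN unit_lattice_lor] assms(4-)])
  obtain e1 x1 y1 f1 where u: "u = (of_int e1, of_int x1, of_int y1, of_int f1)" "odd e1" "even y1" "even (x1 + f1)"
    using assms(1) by (auto simp: unit_lattice_def)
  obtain e2 x2 y2 f2 where v: "v = (of_int e2, of_int x2, of_int y2, of_int f2)" "odd e2" "even y2" "even (x2 + f2)"
    using assms(2) by (auto simp: unit_lattice_def)
  obtain e3 x3 y3 f3 where w: "w = (of_int e3, of_int x3, of_int y3, of_int f3)" "odd e3" "even y3" "even (x3 + f3)"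
    using assms(3) by (auto simp: unit_lattice_def)
  obtain s :: int where s: "\<sigma> = of_int s" using \<sigma> by (metis of_int_1 of_int_minus)
  define e where "e = e1+e2+e3 + s * det3 (x1,y1,f1) (x2,y2,f2) (x3,y3,f3)"
  define x where "x = x1+x2+x3 - s * det3 (e1,y1,f1) (e2,y2,f2) (e3,y3,f3)"
  define y where "y = y1+y2+y3 + s * det3 (e1,x1,f1) (e2,x2,f2) (e3,x3,f3)"
  define f where "f = f1+f2+f3 + s * det3 (e1,x1,y1) (e2,x2,y2) (e3,x3,y3)"
  have d': "d = (of_int e, of_int x, of_int y, of_int f)"
    unfolding d u(1) v(1) w(1) s by (simp add: e_def x_def y_def f_def of_int_det3)
  have col: "even (det3 (a1,b1,c1) (a2,b2,c2) (a3,b3,c3))" "even (det3 (a1,c1,b1) (a2,c2,b2) (a3,c3,b3))"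
    if "even b1" "even b2" "even b3" for a1 a2 a3 b1 b2 b3 c1 c2 c3 :: int
    using that by (simp_all add: det3_def)
  have "even (det3 (e1,x1,f1) (e2,x2,f2) (e3,x3,f3))"
  proof -
    have "det3 (e1,x1,f1) (e2,x2,f2) (e3,x3,f3) = det3 (e1,x1,x1+f1) (e2,x2,x2+f2) (e3,x3,x3+f3)"
      by (simp add: det3_def algebra_simps)
    then show ?thesis using col(2)[OF u(4) v(4) w(4)] by simp
  qed
  moreover have "even ((x1 + f1) + (x2 + f2) + (x3 + f3))"
    by (rule dvd_add[OF dvd_add[OF u(4) v(4)] w(4)])
  moreover have "even (s * det3 (e1,x1,y1) (e2,x2,y2) (e3,x3,y3) - s * det3 (e1,y1,f1) (e2,y2,f2) (e3,y3,f3))"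
    using col u(3) v(3) w(3) by (intro dvd_diff dvd_mult)
  ultimately have ev: "even ((x1 + f1) + (x2 + f2) + (x3 + f3) +
      (s * det3 (e1,x1,y1) (e2,x2,y2) (e3,x3,y3) - s * det3 (e1,y1,f1) (e2,y2,f2) (e3,y3,f3)))"
    "even (s * det3 (e1,x1,f1) (e2,x2,f2) (e3,x3,f3))"
    by (blast intro: dvd_add dvd_mult)+
  have "(x1 + f1) + (x2 + f2) + (x3 + f3) +
      (s * det3 (e1,x1,y1) (e2,x2,y2) (e3,x3,y3) - s * det3 (e1,y1,f1) (e2,y2,f2) (e3,y3,f3)) = x + f"
    by (simp add: x_def f_def)
  moreover have "even (s * det3 (x1,y1,f1) (x2,y2,f2) (x3,y3,f3))"
    using col u(3) v(3) w(3) by (intro dvd_mult)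
  ultimately have par: "odd e" "even y" "even (x + f)"
    using u(2,3) v(2,3) w(2,3) ev by (simp_all only: e_def y_def even_add simp_thms)
  moreover have "e^2 + x^2 + y^2 - f^2 = 1"
  proof -
    have "of_int (e^2 + x^2 + y^2 - f^2) = (1::real)"
      using assms(7) unfolding d' by (simp add: power2_eq_square)
    then show ?thesis by linarith
  qed
  ultimately show ?thesis using par unfolding d' unit_lattice_def by blast
qed

section \<open>Disks as Lorentz unit vectors\<close>

fun curv :: "quad \<Rightarrow> real" where
  "curv (e, x, y, f) = f - e"

fun ctr :: "quad \<Rightarrow> complex" where
  "ctr (e, x, y, f) = Complex (x / (f - e)) (y / (f - e))"

text \<open>A negative radius stands for the closed complement of the ball of radius \<open>- r\<close>.\<close>

definition quad_of :: "complex \<Rightarrow> real \<Rightarrow> quad" where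
  "quad_of c r = (((cmod c)\<^sup>2 - r\<^sup>2 - 1) / (2*r), Re c / r, Im c / r, ((cmod c)\<^sup>2 - r\<^sup>2 + 1) / (2*r))"

fun disk_of :: "quad \<Rightarrow> complex set" where
  "disk_of (e, x, y, f) =
     (if f > e then cball (ctr (e, x, y, f)) (1 / (f - e))
      else if f < e then - ball (ctr (e, x, y, f)) (1 / (e - f))
      else {z. e \<le> Complex x y \<bullet> z})"

abbreviation great_quad :: quad where
  "great_quad \<equiv> (1, 0, 0, 0)"

lemma quad_of_ctr:
  assumes "lor v v = 1" "curv v \<noteq> 0"
  shows "quad_of (ctr v) (1 / curv v) = v"
proof -
  obtain e x y f where v: "v = (e,x,y,f)" by (cases v) auto
  define b where "b = f - e"
  have b: "b \<noteq> 0" "f = e + b" using assms(2) by (auto simp: v b_def)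
  have q: "x^2 + y^2 = 1 + b * (2 * e + b)"
    using assms(1) by (simp add: v b power2_eq_square algebra_simps)
  have c: "(cmod (ctr v))\<^sup>2 = (1 + b * (2 * e + b)) / b^2"
    unfolding q[symmetric] by (simp add: v cmod_power2 b power_divide add_divide_distrib)
  show ?thesis
    unfolding quad_of_def c using b by (simp add: v power2_eq_square field_simps)
qed

lemma lor_quad_of:
  assumes "r \<noteq> 0" "s \<noteq> 0"
  shows "lor (quad_of c r) (quad_of d s) = (r\<^sup>2 + s\<^sup>2 - (dist c d)\<^sup>2) / (2 * r * s)"
proof -
  have "(dist c d)\<^sup>2 = (cmod c)\<^sup>2 + (cmod d)\<^sup>2 - 2 * (Re c * Re d + Im c * Im d)"
    unfolding dist_norm cmod_power2 by (simp add: power2_eq_square algebra_simps)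
  show ?thesis
    unfolding quad_of_def \<open>(dist c d)\<^sup>2 = _\<close> using assms by (simp add: field_simps power2_eq_square)
qed

lemma lor_quad_of_self: "r \<noteq> 0 \<Longrightarrow> lor (quad_of c r) (quad_of c r) = 1"
  by (simp add: lor_quad_of power2_eq_square)

lemma great_quad_eq: "great_quad = quad_of 0 (-1)"
  by (simp add: quad_of_def)

lemma curv_quad_of: "r \<noteq> 0 \<Longrightarrow> curv (quad_of c r) = 1 / r"
  by (simp add: quad_of_def field_simps)

lemma ctr_quad_of: "r \<noteq> 0 \<Longrightarrow> ctr (quad_of c r) = c"
  using curv_quad_of[of r c] by (simp add: quad_of_def complex_eq_iff)

lemma disk_of_curv:
  "curv v > 0 \<Longrightarrow> disk_of v = cball (ctr v) (1 / curv v)"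
  "curv v < 0 \<Longrightarrow> disk_of v = - ball (ctr v) (- 1 / curv v)"
  by (cases v; simp add: minus_divide_right)+

lemma disk_of_quad_of:
  "r > 0 \<Longrightarrow> disk_of (quad_of c r) = cball c r"
  "r > 0 \<Longrightarrow> disk_of (quad_of c (-r)) = - ball c r"
  by (simp_all add: disk_of_curv curv_quad_of ctr_quad_of)

lemma tangent_commute: "tangent D E \<longleftrightarrow> tangent E D"
  by (simp add: tangent_def Int_commute)

lemma tangent_frontierE:
  assumes "tangent D E" "bounded (frontier E)"
  obtains z where "z \<in> frontier D" "z \<in> frontier E"
  using assms by (auto simp: tangent_def disk_boundary_def split: if_splits)

lemma dist_weighted_mean:
  fixes c d :: complex
  assumes "r > 0" "s > 0"
  defines "p \<equiv> (s *\<^sub>R c + r *\<^sub>R d) /\<^sub>R (r + s)"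
  shows "dist c p = r * (dist c d / (r + s))" "dist d p = s * (dist c d / (r + s))"
proof -
  have rs: "r + s > 0" using assms by simp
  have "(r + s) *\<^sub>R p = s *\<^sub>R c + r *\<^sub>R d"
    using rs by (simp add: p_def)
  then have "(r + s) *\<^sub>R (c - p) = r *\<^sub>R (c - d)" "(r + s) *\<^sub>R (d - p) = s *\<^sub>R (d - c)"
    by (simp_all add: algebra_simps)
  from this[THEN arg_cong[of _ _ norm]]
  have "(r + s) * dist c p = r * dist c d" "(r + s) * dist d p = s * dist c d"
    using assms(1,2) rs by (simp_all add: dist_norm norm_minus_commute)
  then show "dist c p = r * (dist c d / (r + s))" "dist d p = s * (dist c d / (r + s))"
    using rs by (simp_all add: field_simps)
qed

lemma disjoint_balls_dist:
  fixes c d :: complex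
  assumes "ball c r \<inter> ball d s = {}" "r > 0" "s > 0"
  shows "r + s \<le> dist c d"
proof (rule ccontr)
  assume "\<not> ?thesis"
  then have "dist c d / (r + s) < 1" using assms by simp
  then have "r * (dist c d / (r + s)) < r * 1" "s * (dist c d / (r + s)) < s * 1"
    using assms by (intro mult_strict_left_mono; simp)+
  then have "(s *\<^sub>R c + r *\<^sub>R d) /\<^sub>R (r + s) \<in> ball c r \<inter> ball d s"
    using assms(2,3) by (simp only: mem_ball Int_iff dist_weighted_mean mult_1_right)
  then show False using assms by blast
qed

lemma tangent_balls_dist:
  fixes c d :: complex
  assumes "tangent (cball c r) (cball d s)" "r > 0" "s > 0"
  shows "dist c d = r + s"
proof -
  obtain z where "z \<in> frontier (cball c r)" "z \<in> frontier (cball d s)"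
    using tangent_frontierE[OF assms(1)] by (auto simp: frontier_cball)
  then have "dist c z = r" "dist d z = s" using assms by (auto simp: frontier_cball)
  then have "dist c d \<le> r + s" using dist_triangle2[of c d z] by simp
  moreover have "ball c r \<inter> ball d s = {}"
    using assms(1) by (simp add: tangent_def interior_cball)
  then have "dist c d \<ge> r + s" using assms by (simp add: disjoint_balls_dist)
  ultimately show ?thesis by simp
qed

lemma tangent_compl_ball_dist:
  fixes c d :: complex
  assumes "tangent (- ball c r) (cball d s)" "r > 0" "s > 0"
  shows "dist c d = r - s"
proof -
  obtain z where "z \<in> frontier (- ball c r)" "z \<in> frontier (cball d s)"
    using tangent_frontierE[OF assms(1)] by (auto simp: frontier_cball)
  then have "dist c z = r" "dist d z = s" using assms by (auto simp: frontier_cball)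
  then have "r \<le> dist c d + s" using dist_triangle[of c z d] by simp
  moreover have "ball d s \<subseteq> cball c r"
    using assms by (auto simp: tangent_def interior_complement)
  then have "dist d c + s \<le> r" using assms unfolding ball_subset_cball_iff by simp
  ultimately show ?thesis by (simp add: dist_commute)
qed

lemma tangent_halfplane_dist:
  fixes n d :: complex
  assumes "tangent {z. e \<le> n \<bullet> z} (cball d s)" "s > 0" "norm n = 1"
  shows "n \<bullet> d = e - s"
proof -
  have n0: "n \<noteq> 0" using assms by auto
  obtain z where "z \<in> frontier {z. e \<le> n \<bullet> z}" "z \<in> frontier (cball d s)"
    using tangent_frontierE[OF assms(1)] by (auto simp: frontier_cball)
  then have z: "n \<bullet> z = e" "dist d z = s"
    using assms frontier_halfspace_ge[of n e] n0 by (auto simp: frontier_cball)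
  have "n \<bullet> (z - d) \<le> norm n * norm (z - d)" by (rule norm_cauchy_schwarz)
  then have "e - s \<le> n \<bullet> d"
    using z assms by (simp add: inner_diff_right dist_norm norm_minus_commute)
  moreover have "n \<bullet> d \<le> e - s"
  proof (rule ccontr)
    assume "\<not> ?thesis"
    then have "max 0 (e - n \<bullet> d) < s" using assms by auto
    then obtain t where t: "max 0 (e - n \<bullet> d) < t" "t < s" using dense by blast
    have "n \<bullet> (d + t *\<^sub>R n) = n \<bullet> d + t"
      using assms by (simp add: inner_add_right power2_norm_eq_inner[symmetric])
    then have "d + t *\<^sub>R n \<in> interior {z. e \<le> n \<bullet> z}"
      using t n0 interior_halfspace_ge[of n e] by auto
    moreover have "d + t *\<^sub>R n \<in> interior (cball d s)"
      using t assms by (simp add: interior_cball dist_norm)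
    ultimately show False using assms(1) by (auto simp: tangent_def)
  qed
  ultimately show ?thesis by simp
qed

lemma tangent_great_disk_interior:
  assumes "tangent D great_disk"
  shows "interior D \<subseteq> cball 0 1"
  using assms by (auto simp: tangent_def great_disk_def interior_complement)

lemma disk_quad:
  assumes "is_disk D"
  obtains w where "lor w w = 1" "D = disk_of w"
    "\<And>c r. r > 0 \<Longrightarrow> tangent D (cball c r) \<Longrightarrow> lor w (quad_of c r) = -1"
    "tangent D great_disk \<Longrightarrow> lor w great_quad = -1"
proof -
  consider (ball) c r where "r > 0" "D = cball c r"
    | (compl) c r where "r > 0" "D = - ball c r"
    | (half) a b where "a \<noteq> 0" "D = {z. a \<bullet> z \<le> b}"
    using assms unfolding is_disk_def by blast
  then show thesis
  proof cases
    case ball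
    show ?thesis
    proof (rule that[of "quad_of c r"])
      show "lor (quad_of c r) (quad_of d s) = -1" if "s > 0" "tangent D (cball d s)" for d s
        using tangent_balls_dist[of c r d s] that ball
        by (simp add: lor_quad_of field_simps power2_eq_square)
      show "lor (quad_of c r) great_quad = -1" if "tangent D great_disk"
      proof -
        have "dist c 0 = 1 - r"
          using tangent_compl_ball_dist[of 0 1 c r] that ball
          by (simp add: great_disk_def tangent_commute dist_commute)
        then have c: "norm c = 1 - r" by simp
        show ?thesis using ball unfolding great_quad_eq
          by (simp add: lor_quad_of c field_simps power2_eq_square)
      qed
    qed (use ball in \<open>simp_all add: lor_quad_of_self disk_of_quad_of\<close>)
  next
    case compl
    show ?thesis
    proof (rule that[of "quad_of c (-r)"])
      show "lor (quad_of c (-r)) (quad_of d s) = -1" if "s > 0" "tangent D (cball d s)" for d s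
      proof -
        have c: "dist c d = r - s" using tangent_compl_ball_dist[of c r d s] that compl by simp
        show ?thesis using that compl by (simp add: lor_quad_of c field_simps power2_eq_square)
      qed
      show "lor (quad_of c (-r)) great_quad = -1" if "tangent D great_disk"
      proof -
        have "- cball c r \<subseteq> cball 0 1"
          using tangent_great_disk_interior[OF that] compl by (simp add: interior_complement)
        then have "UNIV = cball c r \<union> cball 0 1" by auto
        then have "bounded (UNIV :: complex set)" by (metis bounded_Un bounded_cball)
        then show ?thesis by simp
      qed
    qed (use compl in \<open>simp_all add: lor_quad_of_self disk_of_quad_of\<close>)
  next
    case half
    define n where "n = - a /\<^sub>R norm a"
    define e where "e = - b / norm a"
    have n: "norm n = 1" using half by (simp add: n_def)
    have D: "D = {z. e \<le> n \<bullet> z}"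
      using half by (auto simp: n_def e_def field_simps)
    have n2: "(Re n)^2 + (Im n)^2 = 1" using n by (metis cmod_power2 one_power2)
    show ?thesis
    proof (rule that[of "(e, Re n, Im n, e)"])
      show "lor (e, Re n, Im n, e) (e, Re n, Im n, e) = 1"
        using n2 by (simp add: power2_eq_square)
      show "D = disk_of (e, Re n, Im n, e)" by (simp add: D)
      show "lor (e, Re n, Im n, e) (quad_of d s) = -1" if "s > 0" "tangent D (cball d s)" for d s
      proof -
        have e: "e = Re n * Re d + Im n * Im d + s"
          using tangent_halfplane_dist[of e n d s] that n D by (simp add: inner_complex_def)
        show ?thesis using that(1) by (simp add: quad_of_def e field_simps)
      qed
      show "lor (e, Re n, Im n, e) great_quad = -1" if "tangent D great_disk"
      proof -
        have "n \<noteq> 0" using n by auto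
        moreover have "n \<bullet> n = 1" using n by (simp add: norm_eq_1)
        ultimately have "(\<bar>e\<bar> + 2) *\<^sub>R n \<in> interior D"
          using interior_halfspace_ge[of n e] by (simp add: D)
        then have "(\<bar>e\<bar> + 2) *\<^sub>R n \<in> cball 0 1" using tangent_great_disk_interior[OF that] by blast
        then show ?thesis using n by simp
      qed
    qed
  qed
qed

lemma tangent_ballsI:
  fixes c d :: complex
  assumes "dist c d = r + s" "r > 0" "s > 0"
  shows "tangent (cball c r) (cball d s)"
proof -
  define p where "p = (s *\<^sub>R c + r *\<^sub>R d) /\<^sub>R (r + s)"
  have p: "z = p \<longleftrightarrow> dist c z = r \<and> dist d z = s" for z
  proof
    assume z: "z = p"
    show "dist c z = r \<and> dist d z = s"
      using assms unfolding z p_def by (simp add: dist_weighted_mean)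
  next
    assume z: "dist c z = r \<and> dist d z = s"
    have "(norm (s *\<^sub>R (z - c) - r *\<^sub>R (d - z)))\<^sup>2 =
       (r + s) * (s * (dist c z)^2 + r * (dist d z)^2) - r * s * (dist c d)^2"
      by (simp only: dist_norm cmod_power2) (simp add: power2_eq_square algebra_simps)
    also have "\<dots> = 0" using z assms by (simp add: power2_eq_square algebra_simps)
    finally have "s *\<^sub>R (z - c) = r *\<^sub>R (d - z)" by simp
    then have "(r + s) *\<^sub>R z = s *\<^sub>R c + r *\<^sub>R d" by (simp add: algebra_simps)
    then have "z = (s *\<^sub>R c + r *\<^sub>R d) /\<^sub>R (r + s)"
      using assms by (metis add_pos_pos divideR_right less_irrefl)
    then show "z = p" by (simp add: p_def)
  qed
  have "ball c r \<inter> ball d s = {}" using assms by (simp add: disjoint_ballI)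
  moreover have "disk_boundary (cball c r) \<inter> disk_boundary (cball d s) = Some ` {z. dist c z = r \<and> dist d z = s}"
    using assms by (auto simp: disk_boundary_def)
  then have "disk_boundary (cball c r) \<inter> disk_boundary (cball d s) = {Some p}"
    unfolding p[symmetric] by simp
  ultimately show ?thesis by (simp add: tangent_def interior_cball)
qed

lemma tangent_great_disk_ballI:
  assumes "norm d = 1 - s" "0 < s" "s < 1"
  shows "tangent great_disk (cball d s)"
proof -
  define p where "p = d /\<^sub>R (1 - s)"
  have p: "z = p \<longleftrightarrow> norm z = 1 \<and> dist d z = s" for z
  proof
    assume z: "z = p"
    have "(1 - s) *\<^sub>R p = d"
      using assms by (simp add: p_def)
    then have "(1 - s) *\<^sub>R (d - p) = - (s *\<^sub>R d)"
      by (simp add: algebra_simps)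
    from arg_cong[OF this, of norm] have "dist d p = s"
      using assms by (simp add: dist_norm)
    then show "norm z = 1 \<and> dist d z = s"
      using assms unfolding z by (simp add: p_def)
  next
    assume z: "norm z = 1 \<and> dist d z = s"
    have "(norm ((1 - s) *\<^sub>R z - d))\<^sup>2 =
       (1 - s) * (dist d z)^2 - s * (1 - s) * (norm z)^2 + s * (norm d)^2"
      by (simp only: dist_norm cmod_power2) (simp add: power2_eq_square algebra_simps)
    also have "\<dots> = 0" using z by (simp add: assms(1) power2_eq_square algebra_simps)
    finally have "(1 - s) *\<^sub>R z = d" by simp
    then show "z = p"
      unfolding p_def using assms by (metis diff_gt_0_iff_gt divideR_right less_irrefl)
  qed
  have "ball d s \<subseteq> cball 0 1"
    unfolding ball_subset_cball_iff using assms by simp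
  then have "- cball 0 1 \<inter> ball d s = {}" by blast
  moreover have "disk_boundary great_disk \<inter> disk_boundary (cball d s) = Some ` {z. norm z = 1 \<and> dist d z = s}"
    using assms by (auto simp: disk_boundary_def great_disk_def)
  then have "disk_boundary great_disk \<inter> disk_boundary (cball d s) = {Some p}"
    unfolding p[symmetric] by simp
  ultimately show ?thesis by (simp add: tangent_def interior_cball great_disk_def interior_complement)
qed

lemma dist_ctr:
  assumes "lor u u = 1" "lor v v = 1" "curv u \<noteq> 0" "curv v \<noteq> 0"
    and r: "r = 1 / curv u" and s: "s = 1 / curv v"
  shows "(dist (ctr u) (ctr v))\<^sup>2 = r\<^sup>2 + s\<^sup>2 - 2 * (r * s) * lor u v"
proof -
  have "r \<noteq> 0" "s \<noteq> 0" using assms by simp_all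
  moreover have "lor u v = (r\<^sup>2 + s\<^sup>2 - (dist (ctr u) (ctr v))\<^sup>2) / (2 * r * s)"
    using lor_quad_of[OF calculation, of "ctr u" "ctr v"] quad_of_ctr[OF assms(1,3)]
      quad_of_ctr[OF assms(2,4)] r s by simp
  ultimately show ?thesis by simp
qed

section \<open>Nested and disjoint disks\<close>

definition nested :: "quad \<Rightarrow> quad \<Rightarrow> bool" where
  "nested u v \<longleftrightarrow> 1 \<le> lor u v \<and> curv u \<le> curv v"

lemma zero_le_mult_iff_pos: "0 < a \<Longrightarrow> 0 \<le> a * b \<longleftrightarrow> 0 \<le> (b::real)"
  by (simp add: zero_le_mult_iff)

context
  fixes u v :: quad
  assumes unit: "lor u u = 1" "lor v v = 1" and pos: "curv u > 0" "curv v > 0"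
begin

lemma lor_le_iff_dist: "lor u v \<le> -1 \<longleftrightarrow> 1 / curv u + 1 / curv v \<le> dist (ctr u) (ctr v)"
proof -
  define r s where "r = 1 / curv u" and "s = 1 / curv v"
  have rs: "r > 0" "s > 0" using pos by (simp_all add: r_def s_def)
  have "(dist (ctr u) (ctr v))\<^sup>2 - (r + s)\<^sup>2 = 2 * (r * s) * (- 1 - lor u v)"
    using dist_ctr[OF unit _ _ r_def s_def] pos by (simp add: power2_eq_square algebra_simps)
  moreover have "0 \<le> 2 * (r * s) * (- 1 - lor u v) \<longleftrightarrow> lor u v \<le> -1"
    by (subst zero_le_mult_iff_pos) (use rs in simp_all)
  moreover have "0 \<le> (dist (ctr u) (ctr v))\<^sup>2 - (r + s)\<^sup>2 \<longleftrightarrow> r + s \<le> dist (ctr u) (ctr v)"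
    using rs by (simp add: power_mono_iff)
  ultimately show ?thesis unfolding r_def s_def by simp
qed

lemma lor_eq_iff_dist: "lor u v = -1 \<longleftrightarrow> dist (ctr u) (ctr v) = 1 / curv u + 1 / curv v"
proof -
  define r s where "r = 1 / curv u" and "s = 1 / curv v"
  have rs: "r > 0" "s > 0" using pos by (simp_all add: r_def s_def)
  have "(dist (ctr u) (ctr v))\<^sup>2 - (r + s)\<^sup>2 = 2 * (r * s) * (- 1 - lor u v)"
    using dist_ctr[OF unit _ _ r_def s_def] pos by (simp add: power2_eq_square algebra_simps)
  moreover have "2 * (r * s) * (- 1 - lor u v) = 0 \<longleftrightarrow> lor u v = -1"
    using rs by auto
  moreover have "(dist (ctr u) (ctr v))\<^sup>2 - (r + s)\<^sup>2 = 0 \<longleftrightarrow> dist (ctr u) (ctr v) = r + s"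
    using rs by simp
  ultimately show ?thesis unfolding r_def s_def by simp
qed

lemma nested_iff_dist: "nested u v \<longleftrightarrow> dist (ctr u) (ctr v) + 1 / curv v \<le> 1 / curv u"
proof -
  define r s where "r = 1 / curv u" and "s = 1 / curv v"
  have rs: "r > 0" "s > 0" using pos by (simp_all add: r_def s_def)
  have "(r - s)\<^sup>2 - (dist (ctr u) (ctr v))\<^sup>2 = 2 * (r * s) * (lor u v - 1)"
    using dist_ctr[OF unit _ _ r_def s_def] pos by (simp add: power2_eq_square algebra_simps)
  moreover have "0 \<le> 2 * (r * s) * (lor u v - 1) \<longleftrightarrow> 1 \<le> lor u v"
    by (subst zero_le_mult_iff_pos) (use rs in simp_all)
  moreover have "0 \<le> (r - s)\<^sup>2 - (dist (ctr u) (ctr v))\<^sup>2 \<longleftrightarrow> dist (ctr u) (ctr v) \<le> \<bar>r - s\<bar>"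
    using abs_le_square_iff[of "dist (ctr u) (ctr v)" "r - s"]
    by (simp only: diff_ge_0_iff_ge abs_of_nonneg zero_le_dist)
  ultimately have "1 \<le> lor u v \<longleftrightarrow> dist (ctr u) (ctr v) \<le> \<bar>r - s\<bar>" by simp
  moreover have "curv u \<le> curv v \<longleftrightarrow> s \<le> r"
    unfolding r_def s_def inverse_eq_divide[symmetric] by (rule inverse_le_iff_le[OF pos(2,1), symmetric])
  ultimately have "nested u v \<longleftrightarrow> dist (ctr u) (ctr v) \<le> \<bar>r - s\<bar> \<and> s \<le> r"
    unfolding nested_def by blast
  also have "\<dots> \<longleftrightarrow> dist (ctr u) (ctr v) + s \<le> r"
    using zero_le_dist[of "ctr u" "ctr v"] by linarith
  finally show ?thesis unfolding r_def s_def .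
qed

lemma nested_cases: "1 \<le> lor u v \<Longrightarrow> nested u v \<or> nested v u"
  by (auto simp: nested_def lor_commute)

lemma nested_same_curv:
  assumes "nested u v" "curv u = curv v"
  shows "u = v"
proof -
  have "ctr u = ctr v" using assms(1) unfolding nested_iff_dist assms(2) by simp
  then have "quad_of (ctr u) (1 / curv u) = quad_of (ctr v) (1 / curv v)" using assms(2) by simp
  then show ?thesis using quad_of_ctr[OF unit(1)] quad_of_ctr[OF unit(2)] pos by simp
qed

end

lemma nested_trans:
  assumes "nested u v" "nested v w" "lor u u = 1" "lor v v = 1" "lor w w = 1"
    "curv u > 0" "curv v > 0" "curv w > 0"
  shows "nested u w"
  using assms dist_triangle[of "ctr u" "ctr w" "ctr v"] by (simp add: nested_iff_dist)

lemma same_ray_norm_diff: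
  fixes x y z :: "'a::real_inner"
  assumes "norm x *\<^sub>R y = norm y *\<^sub>R x" "norm x *\<^sub>R z = norm z *\<^sub>R x" "x \<noteq> 0"
  shows "norm (y - z) = \<bar>norm y - norm z\<bar>"
proof -
  have "norm x *\<^sub>R (y - z) = (norm y - norm z) *\<^sub>R x"
    using assms by (simp add: algebra_simps)
  from arg_cong[OF this, of norm] show ?thesis using assms(3) by simp
qed

text \<open>
  Both disks must touch the ball around \<open>c\<close> at its single common boundary point with the larger
  ball around \<open>b\<close>.
\<close>

lemma no_two_tangent_in_ball:
  fixes b c c1 c2 :: "'a::real_inner"
  assumes "dist b c + r \<le> s" "b \<noteq> c" "r > 0" "r1 > 0" "r2 > 0"
    and "dist c c1 = r + r1" "s + r1 \<le> dist b c1"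
    and "dist c c2 = r + r2" "s + r2 \<le> dist b c2"
  shows "dist c1 c2 \<noteq> r1 + r2"
proof -
  have *: "norm (c - b) *\<^sub>R (a - c) = norm (a - c) *\<^sub>R (c - b)"
    if "dist c a = r + t" "s + t \<le> dist b a" for a t
  proof -
    have "dist b a \<le> dist b c + dist c a" by (rule dist_triangle)
    then have "dist b a = dist b c + dist c a" using that assms(1) by linarith
    then have "norm ((c - b) + (a - c)) = norm (c - b) + norm (a - c)"
      by (simp add: dist_norm norm_minus_commute)
    then show ?thesis unfolding norm_triangle_eq .
  qed
  have "norm ((c1 - c) - (c2 - c)) = \<bar>norm (c1 - c) - norm (c2 - c)\<bar>"
    using same_ray_norm_diff[OF *[OF assms(6,7)] *[OF assms(8,9)]] assms(2) by simp
  then have "dist c1 c2 = \<bar>r1 - r2\<bar>"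
    using assms(6,8) by (simp add: dist_norm norm_minus_commute)
  then show ?thesis using assms by linarith
qed

lemma no_two_tangent_outside_ball:
  fixes c c1 c2 :: "'a::real_inner"
  assumes "1 + r \<le> norm c" "r > 0" "r1 > 0" "r2 > 0"
    and "dist c c1 = r + r1" "norm c1 \<le> 1 - r1"
    and "dist c c2 = r + r2" "norm c2 \<le> 1 - r2"
  shows "dist c1 c2 \<noteq> r1 + r2"
proof -
  have *: "norm c *\<^sub>R a = norm a *\<^sub>R c \<and> norm a = 1 - t"
    if "dist c a = r + t" "norm a \<le> 1 - t" for a t
  proof -
    have "norm (a + (c - a)) \<le> norm a + norm (c - a)" by (rule norm_triangle_ineq)
    then have eq: "norm (a + (c - a)) = norm a + norm (c - a)" and na: "norm a = 1 - t" and "norm c = norm a + norm (c - a)"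
      using that assms(1) by (simp_all add: dist_norm)
    then have "norm c *\<^sub>R a = norm a *\<^sub>R a + norm (c - a) *\<^sub>R a"
      by (simp add: scaleR_add_left)
    also have "\<dots> = norm a *\<^sub>R a + norm a *\<^sub>R (c - a)"
      using eq unfolding norm_triangle_eq by simp
    finally show ?thesis using na by (simp add: scaleR_add_right[symmetric])
  qed
  have "norm (c1 - c2) = \<bar>norm c1 - norm c2\<bar>"
    using same_ray_norm_diff[of c c1 c2] *[OF assms(5,6)] *[OF assms(7,8)] assms(1,2) by force
  then have "dist c1 c2 = \<bar>r1 - r2\<bar>"
    using *[OF assms(5,6)] *[OF assms(7,8)] by (simp add: dist_norm)
  then show ?thesis using assms by linarith
qed

section \<open>The invariant of the packing\<close>

text \<open>The bound 2 on the integral curvature excludes only the unit disk itself.\<close>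

definition inner_quads :: "quad set" where
  "inner_quads = {v \<in> unit_lattice. 2 \<le> curv v \<and> lor v great_quad \<le> -1}"

definition maximal_quad :: "quad \<Rightarrow> bool" where
  "maximal_quad v \<longleftrightarrow> v \<in> inner_quads \<and> (\<forall>u\<in>inner_quads. nested u v \<longrightarrow> u = v)"

lemma curv_int:
  assumes "v \<in> unit_lattice"
  obtains k :: int where "curv v = of_int k"
proof -
  obtain e x y f where "v = (of_int e, of_int x, of_int y, of_int f)"
    using assms unfolding unit_lattice_def by blast
  then show ?thesis using that[of "f - e"] by simp
qed

lemma great_quad_unit_lattice: "great_quad \<in> unit_lattice"
  unfolding unit_lattice_def
  by (rule CollectI, rule exI[of _ 1], rule exI[of _ 0], rule exI[of _ 0], rule exI[of _ 0]) simp

lemma norm_ctr: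
  assumes "lor v v = 1" "curv v > 0"
  shows "(norm (ctr v))\<^sup>2 = 1 + (1 / curv v)\<^sup>2 + 2 * (1 / curv v) * lor v great_quad"
proof -
  have "ctr great_quad = 0" by (simp add: complex_eq_iff)
  then show ?thesis
    using dist_ctr[OF assms(1), of great_quad, OF _ _ _ refl refl] assms(2) by (simp del: ctr.simps)
qed

lemma inner_quadsD:
  assumes "v \<in> inner_quads"
  shows "v \<in> unit_lattice" "lor v v = 1" "curv v > 0" "norm (ctr v) \<le> 1 - 1 / curv v"
proof -
  show *: "v \<in> unit_lattice" "lor v v = 1" "curv v > 0"
    using assms unit_lattice_lor by (auto simp: inner_quads_def)
  define r where "r = 1 / curv v"
  have r: "r > 0" "r \<le> 1" using assms by (auto simp: inner_quads_def r_def)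
  have "r * lor v great_quad \<le> r * -1"
    using assms r by (intro mult_left_mono) (auto simp: inner_quads_def)
  then have "(norm (ctr v))\<^sup>2 \<le> (1 - r)\<^sup>2"
    unfolding norm_ctr[OF *(2,3)] r_def[symmetric] by (simp add: power2_eq_square algebra_simps)
  then show "norm (ctr v) \<le> 1 - 1 / curv v"
    using r power2_le_imp_le[of "norm (ctr v)" "1 - r"] by (simp add: r_def)
qed

lemma inner_quadsI:
  assumes "v \<in> unit_lattice" "curv v > 0" "curv v \<noteq> 1" "lor v great_quad \<le> -1"
  shows "v \<in> inner_quads"
proof -
  obtain k where "curv v = of_int k" using curv_int[OF assms(1)] .
  then show ?thesis using assms by (simp add: inner_quads_def)
qed

lemma unit_circle_quad:
  assumes "v \<in> unit_lattice" "curv v = 1" "lor v great_quad \<le> -1"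
  shows "ctr v = 0"
proof -
  have "(norm (ctr v))\<^sup>2 \<le> 0"
    using norm_ctr[of v] assms unit_lattice_lor by simp
  then show ?thesis by simp
qed

lemma maximal_quad_disjoint:
  assumes "maximal_quad v" "u \<in> inner_quads" "nested u w" "lor w v = -1" "lor w w = 1" "curv w > 0"
  shows "lor u v \<le> -1"
proof (rule ccontr)
  assume neg: "\<not> ?thesis"
  have v: "v \<in> inner_quads" using assms by (simp add: maximal_quad_def)
  have "1 \<le> lor u v" using lor_le_or_ge[of u v] neg inner_quadsD(1) assms(2) v by blast
  then have "nested v u \<or> nested u v" using nested_cases inner_quadsD[OF v] inner_quadsD[OF assms(2)] by blast
  then have "nested v u \<or> u = v" using assms by (auto simp: maximal_quad_def)
  then have "nested v w" using nested_trans[of v u w] inner_quadsD[OF v] inner_quadsD[OF assms(2)] assms by blast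
  then show False using assms(4) by (simp add: nested_def lor_commute)
qed

lemma maximal_quad_if_pos_curv:
  assumes "maximal_quad v1" "maximal_quad v2" "lor v1 v2 = -1"
    and w: "w \<in> unit_lattice" "lor w v1 = -1" "lor w v2 = -1" and pos: "curv w > 0"
  shows "maximal_quad w"
proof -
  have in12: "v1 \<in> inner_quads" "v2 \<in> inner_quads" using assms by (simp_all add: maximal_quad_def)
  note v1 = inner_quadsD[OF in12(1)] and v2 = inner_quadsD[OF in12(2)]
  have ww: "lor w w = 1" using w unit_lattice_lor by blast
  have d12: "dist (ctr v1) (ctr v2) = 1 / curv v1 + 1 / curv v2"
    using lor_eq_iff_dist[OF v1(2) v2(2) v1(3) v2(3)] assms by simp
  have dw: "dist (ctr w) (ctr v1) = 1 / curv w + 1 / curv v1" "dist (ctr w) (ctr v2) = 1 / curv w + 1 / curv v2"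
    using lor_eq_iff_dist[OF ww v1(2) pos v1(3)] lor_eq_iff_dist[OF ww v2(2) pos v2(3)] w by simp_all
  define r where "r = 1 / curv w"
  have r: "r > 0" using pos by (simp add: r_def)
  have below: "lor w great_quad \<le> -1"
  proof (rule ccontr)
    assume "\<not> ?thesis"
    then have "1 \<le> lor w great_quad" using lor_le_or_ge[OF w(1) great_quad_unit_lattice] by blast
    then have "r * 1 \<le> r * lor w great_quad" using r by (intro mult_left_mono) auto
    then have "(1 + r)\<^sup>2 \<le> (norm (ctr w))\<^sup>2"
      unfolding norm_ctr[OF ww pos] r_def[symmetric] by (simp add: power2_eq_square algebra_simps)
    then have "1 + 1 / curv w \<le> norm (ctr w)" using r power2_le_imp_le[of "1 + r" "norm (ctr w)"] by (simp add: r_def)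
    then show False
      using no_two_tangent_outside_ball[OF _ _ _ _ dw(1) v1(4) dw(2) v2(4)] d12 pos v1(3) v2(3) by simp
  qed
  have "curv w \<noteq> 1"
  proof
    assume 1: "curv w = 1"
    then have "ctr w = 0" using unit_circle_quad w below by blast
    then have "norm (ctr v1) = 1 + 1 / curv v1" using dw 1 by simp
    moreover have "1 / curv v1 > 0" using v1(3) by simp
    ultimately show False using v1(4) by linarith
  qed
  then have "w \<in> inner_quads" using inner_quadsI w pos below by blast
  moreover have "u = w" if u: "u \<in> inner_quads" "nested u w" for u
  proof (rule ccontr)
    assume "u \<noteq> w"
    note u' = inner_quadsD[OF u(1)]
    have d: "dist (ctr u) (ctr w) + 1 / curv w \<le> 1 / curv u"
      using u(2) nested_iff_dist[OF u'(2) ww u'(3) pos] by simp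
    have far: "1 / curv u + 1 / curv v1 \<le> dist (ctr u) (ctr v1)" "1 / curv u + 1 / curv v2 \<le> dist (ctr u) (ctr v2)"
      using maximal_quad_disjoint[OF assms(1) u w(2) ww pos] lor_le_iff_dist[OF u'(2) v1(2) u'(3) v1(3)]
        maximal_quad_disjoint[OF assms(2) u w(3) ww pos] lor_le_iff_dist[OF u'(2) v2(2) u'(3) v2(3)] by simp_all
    have "ctr u \<noteq> ctr w"
    proof
      assume eq: "ctr u = ctr w"
      then have "1 / curv u = 1 / curv w" using d far(1) dw(1) by simp
      then have "curv u = curv w" by simp
      then show False using nested_same_curv[OF u'(2) ww u'(3) pos u(2)] \<open>u \<noteq> w\<close> by blast
    qed
    then show False
      using no_two_tangent_in_ball[OF d _ _ _ _ dw(1) far(1) dw(2) far(2)] d12 pos v1(3) v2(3) by simp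
  qed
  ultimately show ?thesis by (auto simp: maximal_quad_def)
qed

lemma no_zero_curv:
  assumes "maximal_quad v1" "maximal_quad v2" "lor v1 v2 = -1"
    and w: "w \<in> unit_lattice" "lor w v1 = -1" "lor w v2 = -1"
  shows "curv w \<noteq> 0"
proof
  assume 0: "curv w = 0"
  obtain e x y where we: "w = (e, x, y, e)" using 0 by (cases w) auto
  define n where "n = Complex x y"
  have "x\<^sup>2 + y\<^sup>2 = 1" using unit_lattice_lor[OF w(1)] by (simp add: we power2_eq_square)
  then have n: "norm n = 1" by (simp add: n_def cmod_def)
  have in12: "v1 \<in> inner_quads" "v2 \<in> inner_quads" using assms by (simp_all add: maximal_quad_def)
  note v1 = inner_quadsD[OF in12(1)] and v2 = inner_quadsD[OF in12(2)]
  have ray: "norm n *\<^sub>R ctr v = norm (ctr v) *\<^sub>R n \<and> norm (ctr v) = 1 - 1 / curv v"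
    if v: "v \<in> inner_quads" and wv: "lor w v = -1" for v
  proof -
    note v' = inner_quadsD[OF v]
    define c r where "c = ctr v" and "r = 1 / curv v"
    have r: "0 < r" using v' by (simp add: r_def)
    have "v = quad_of c r" using quad_of_ctr[of v] v' by (simp add: c_def r_def)
    then have "lor w v = (n \<bullet> c - e) / r"
      by (simp add: we quad_of_def n_def inner_complex_def diff_divide_distrib add_divide_distrib algebra_simps)
    then have nc: "n \<bullet> c = e - r" using wv r by (simp add: field_simps)
    have c: "norm c \<le> 1 - r" using v'(4) by (simp add: c_def r_def)
    have "\<bar>n \<bullet> c\<bar> \<le> norm c" using Cauchy_Schwarz_ineq2[of n c] n by simp
    then have "e \<le> 1" "-1 < e" using nc c r by linarith+
    moreover obtain k :: int where "odd k" "e = of_int k"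
      using w(1) by (auto simp: unit_lattice_def we)
    ultimately have "k \<le> 1" "-1 < k" by linarith+
    then have "k = 1" using \<open>odd k\<close> by presburger
    then have "n \<bullet> c = 1 - r" using nc \<open>e = of_int k\<close> by simp
    moreover from this have nc1: "norm c = 1 - r"
      using c \<open>\<bar>n \<bullet> c\<bar> \<le> norm c\<close> by linarith
    ultimately have "n \<bullet> c = norm n * norm c" using n by simp
    then show ?thesis
      using nc1 unfolding norm_cauchy_schwarz_eq by (simp add: c_def r_def)
  qed
  have "norm (ctr v1 - ctr v2) = \<bar>norm (ctr v1) - norm (ctr v2)\<bar>"
    using same_ray_norm_diff[of n "ctr v1" "ctr v2"] ray[OF in12(1) w(2)] ray[OF in12(2) w(3)] n by force
  then have "dist (ctr v1) (ctr v2) = \<bar>1 / curv v1 - 1 / curv v2\<bar>"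
    using ray[OF in12(1) w(2)] ray[OF in12(2) w(3)] by (simp add: dist_norm)
  moreover have "dist (ctr v1) (ctr v2) = 1 / curv v1 + 1 / curv v2"
    using lor_eq_iff_dist[OF v1(2) v2(2) v1(3) v2(3)] assms by simp
  moreover have "1 / curv v1 > 0" "1 / curv v2 > 0" using v1 v2 by simp_all
  ultimately show False by linarith
qed

lemma lor_minus: "lor (- u) v = - lor u v" "lor u (- v) = - lor u v"
  by (cases u; cases v; simp)+

lemma curv_minus: "curv (- u) = - curv u"
  by (cases u) simp

lemma unit_lattice_minus: "v \<in> unit_lattice \<Longrightarrow> - v \<in> unit_lattice"
proof -
  assume "v \<in> unit_lattice"
  then obtain e x y f :: int where "v = (of_int e, of_int x, of_int y, of_int f)"
    "odd e" "even y" "even (x + f)" "e^2 + x^2 + y^2 - f^2 = 1"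
    unfolding unit_lattice_def by blast
  then have "- v = (of_int (-e), of_int (-x), of_int (-y), of_int (-f))"
    "odd (-e)" "even (-y)" "even (-x + -f)" "(-e)^2 + (-x)^2 + (-y)^2 - (-f)^2 = 1"
    by simp_all
  then show ?thesis unfolding unit_lattice_def by blast
qed

lemma great_quad_if_neg_curv:
  assumes "maximal_quad v1" "maximal_quad v2" "lor v1 v2 = -1"
    and w: "w \<in> unit_lattice" "lor w v1 = -1" "lor w v2 = -1" and neg: "curv w < 0"
  shows "w = great_quad"
proof -
  define b where "b = - w"
  have b: "b \<in> unit_lattice" "lor b b = 1" "curv b > 0" "lor b v1 = 1" "lor b v2 = 1"
    using w neg unit_lattice_minus unit_lattice_lor by (auto simp: b_def lor_minus curv_minus)
  have in12: "v1 \<in> inner_quads" "v2 \<in> inner_quads" using assms by (simp_all add: maximal_quad_def)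
  note v1 = inner_quadsD[OF in12(1)] and v2 = inner_quadsD[OF in12(2)]
  define r1 r2 R where "r1 = 1 / curv v1" and "r2 = 1 / curv v2" and "R = 1 / curv b"
  have pos: "r1 > 0" "r2 > 0" "R > 0" using v1 v2 b by (simp_all add: r1_def r2_def R_def)
  have d12: "dist (ctr v1) (ctr v2) = r1 + r2"
    using lor_eq_iff_dist[OF v1(2) v2(2) v1(3) v2(3)] assms by (simp add: r1_def r2_def)
  have n1: "nested b v1 \<or> nested v1 b" and n2: "nested b v2 \<or> nested v2 b"
    using nested_cases[OF b(2) v1(2) b(3) v1(3)] nested_cases[OF b(2) v2(2) b(3) v2(3)] b by simp_all
  note nd = nested_iff_dist[OF b(2) v1(2) b(3) v1(3)] nested_iff_dist[OF v1(2) b(2) v1(3) b(3)]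
    nested_iff_dist[OF b(2) v2(2) b(3) v2(3)] nested_iff_dist[OF v2(2) b(2) v2(3) b(3)]
  note nd = nd[folded r1_def r2_def R_def]
  have tri: "r1 + r2 \<le> dist (ctr b) (ctr v1) + dist (ctr b) (ctr v2)"
    using dist_triangle[of "ctr v1" "ctr v2" "ctr b"] d12 by (simp add: dist_commute)
  have "\<not> nested v1 b"
  proof
    assume "nested v1 b"
    then have "dist (ctr b) (ctr v1) + R \<le> r1" unfolding nd by (simp add: dist_commute)
    moreover from n2 have "dist (ctr b) (ctr v2) \<le> r2 - R \<or> dist (ctr b) (ctr v2) \<le> R - r2"
      unfolding nd by (auto simp: dist_commute algebra_simps)
    ultimately show False using tri pos by linarith
  qed
  moreover have "\<not> nested v2 b"
  proof
    assume "nested v2 b"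
    then have "dist (ctr b) (ctr v2) + R \<le> r2" unfolding nd by (simp add: dist_commute)
    moreover from n1 have "dist (ctr b) (ctr v1) \<le> r1 - R \<or> dist (ctr b) (ctr v1) \<le> R - r1"
      unfolding nd by (auto simp: dist_commute algebra_simps)
    ultimately show False using tri pos by linarith
  qed
  ultimately have n: "nested b v1" "nested b v2" using n1 n2 by blast+
  have "lor b great_quad \<le> -1"
  proof (rule ccontr)
    assume "\<not> ?thesis"
    then have "1 \<le> lor b great_quad" using lor_le_or_ge[OF b(1) great_quad_unit_lattice] by blast
    then have "R * 1 \<le> R * lor b great_quad" using pos by (intro mult_left_mono) auto
    then have "(1 + R)\<^sup>2 \<le> (norm (ctr b))\<^sup>2"
      unfolding norm_ctr[OF b(2,3)] R_def[symmetric] by (simp add: power2_eq_square algebra_simps)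
    then have "1 + R \<le> norm (ctr b)" using pos power2_le_imp_le[of "1 + R" "norm (ctr b)"] by simp
    moreover have "norm (ctr b) \<le> norm (ctr v1) + dist (ctr b) (ctr v1)"
      using norm_triangle_sub[of "ctr b" "ctr v1"] by (simp add: dist_norm)
    moreover have "dist (ctr b) (ctr v1) + r1 \<le> R" using n(1) unfolding nd .
    moreover have "norm (ctr v1) \<le> 1 - r1" using v1(4) by (simp add: r1_def)
    ultimately show False using pos by linarith
  qed
  moreover have "curv b = 1"
  proof (rule ccontr)
    assume "curv b \<noteq> 1"
    then have "b \<in> inner_quads" using inner_quadsI b calculation by blast
    then have "b = v1" "b = v2" using n assms by (auto simp: maximal_quad_def)
    then show False using assms(3) b(2) by simp
  qed
  ultimately have "ctr b = 0" using unit_circle_quad b by blast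
  then have "b = quad_of 0 1" using quad_of_ctr[of b] b \<open>curv b = 1\<close> by simp
  moreover have "w = - b" by (simp add: b_def)
  ultimately have "w = - quad_of 0 1" by simp
  then show ?thesis by (simp add: quad_of_def)
qed

definition window_quad :: "quad \<Rightarrow> bool" where
  "window_quad v \<longleftrightarrow> v = great_quad \<or> maximal_quad v"

lemma window_quad_unit_lattice: "window_quad v \<Longrightarrow> v \<in> unit_lattice"
  using great_quad_unit_lattice inner_quadsD(1) unfolding window_quad_def maximal_quad_def by metis

lemma window_quad_step:
  assumes "maximal_quad v1" "maximal_quad v2" "lor v1 v2 = -1"
    and "w \<in> unit_lattice" "lor w v1 = -1" "lor w v2 = -1"
  shows "window_quad w"
proof -
  consider "curv w > 0" | "curv w < 0" using no_zero_curv[OF assms] by linarith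
  then show ?thesis
    using maximal_quad_if_pos_curv[OF assms] great_quad_if_neg_curv[OF assms]
    by cases (simp_all add: window_quad_def)
qed

lemma disk_of_great_quad: "disk_of great_quad = great_disk"
  using disk_of_quad_of(2)[of 1 0] by (simp add: great_quad_eq great_disk_def del: disk_of.simps)

lemma disk_of_maximal_quad:
  assumes "maximal_quad v"
  shows "disk_of v = cball (ctr v) (1 / curv v)" "1 / curv v > 0" "quad_of (ctr v) (1 / curv v) = v"
  using assms inner_quadsD[of v] by (simp_all add: maximal_quad_def disk_of_curv quad_of_ctr)

lemma not_tangent_great_disk: "\<not> tangent great_disk great_disk"
proof
  assume "tangent great_disk great_disk"
  from tangent_great_disk_interior[OF this] have "- cball 0 1 \<subseteq> (cball 0 1 :: complex set)"
    by (simp add: great_disk_def interior_complement)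
  moreover have "(2::complex) \<in> - cball 0 1" by simp
  ultimately show False by blast
qed

lemma tangent_window_quads:
  assumes "window_quad u" "window_quad v" "tangent (disk_of u) (disk_of v)"
  shows "lor u v = -1"
proof -
  have great: "lor great_quad v = -1" if "maximal_quad v" "tangent great_disk (disk_of v)" for v
  proof -
    have d: "dist 0 (ctr v) = 1 - 1 / curv v"
      using that disk_of_maximal_quad[OF that(1)] tangent_compl_ball_dist[of 0 1 "ctr v" "1 / curv v"]
      by (simp add: great_disk_def)
    define r where "r = 1 / curv v"
    have c: "norm (ctr v) = 1 - r" using d by (simp add: r_def)
    have "lor (quad_of 0 (-1)) (quad_of (ctr v) r) = -1"
      using disk_of_maximal_quad(2)[OF that(1)] unfolding r_def[symmetric]
      by (subst lor_quad_of) (auto simp: c field_simps power2_eq_square)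
    then show ?thesis using disk_of_maximal_quad(3)[OF that(1)] unfolding great_quad_eq r_def by simp
  qed
  consider "u = great_quad" "v = great_quad" | "u = great_quad" "maximal_quad v"
    | "maximal_quad u" "v = great_quad" | "maximal_quad u" "maximal_quad v"
    using assms by (auto simp: window_quad_def)
  then show ?thesis
  proof cases
    case 1
    then show ?thesis using assms(3) not_tangent_great_disk disk_of_great_quad by metis
  next
    case 2
    then show ?thesis using great assms(3) disk_of_great_quad by metis
  next
    case 3
    then show ?thesis using great assms(3) disk_of_great_quad tangent_commute lor_commute by metis
  next
    case 4
    note u = disk_of_maximal_quad[OF 4(1)] and v = disk_of_maximal_quad[OF 4(2)]
    have "dist (ctr u) (ctr v) = 1 / curv u + 1 / curv v"
      using tangent_balls_dist assms(3) u v by metis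
    then show ?thesis using lor_eq_iff_dist[of u v] u v 4 inner_quadsD by (simp add: maximal_quad_def)
  qed
qed

lemma disk_of_seeds:
  "disk_of (-1, 1, 0, 1) = cball (1/2) (1/2)" "disk_of (-1, -1, 0, 1) = cball (-1/2) (1/2)"
proof -
  have "ctr (-1, 1, 0, 1) = 1/2" "ctr (-1, -1, 0, 1) = -1/2" by (simp_all add: complex_eq_iff)
  moreover have "disk_of (-1, x, 0, 1) = cball (ctr (-1, x, 0, 1)) (1/2)" for x by simp
  ultimately show "disk_of (-1, 1, 0, 1) = cball (1/2) (1/2)" "disk_of (-1, -1, 0, 1) = cball (-1/2) (1/2)"
    by (simp_all only:)
qed

lemma packing_window_quad:
  assumes "D \<in> apollonian_window"
  shows "\<exists>v. window_quad v \<and> D = disk_of v"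
  using assms unfolding apollonian_window_def
proof (induction rule: apollonian_packing.induct)
  case (seed D)
  have max: "maximal_quad (-1, x, 0, 1)" if "x = -1 \<or> x = 1" for x
  proof -
    have *: "(-1, x, 0, 1) = (of_int (-1), of_int (if x = 1 then 1 else -1), of_int 0, of_int 1)"
      using that by auto
    have "(-1, x, 0, 1) \<in> unit_lattice"
      unfolding * unit_lattice_def by (rule CollectI, (rule exI)+, rule conjI[OF refl]) auto
    then have v: "(-1, x, 0, 1) \<in> inner_quads" by (simp add: inner_quads_def)
    moreover have "u = (-1, x, 0, 1)" if u: "u \<in> inner_quads" "nested u (-1, x, 0, 1)" for u
    proof -
      have "curv u = curv (-1, x, 0, 1)" using u by (simp add: inner_quads_def nested_def)
      then show ?thesis using nested_same_curv[OF _ _ _ _ u(2)] inner_quadsD[OF u(1)] inner_quadsD[OF v] by blast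
    qed
    ultimately show ?thesis by (auto simp: maximal_quad_def)
  qed
  show ?case using seed max[of 1] max[of "-1"] disk_of_great_quad disk_of_seeds
    unfolding window_quad_def by (simp del: disk_of.simps) metis
next
  case (adjoin D1 D2 D3 D)
  obtain v1 v2 v3 where v: "window_quad v1" "window_quad v2" "window_quad v3"
    and D: "D1 = disk_of v1" "D2 = disk_of v2" "D3 = disk_of v3"
    using adjoin.IH by blast
  note l = v[THEN window_quad_unit_lattice]
  have t: "lor v1 v2 = -1" "lor v1 v3 = -1" "lor v2 v3 = -1"
    using tangent_window_quads v adjoin.hyps unfolding D by blast+
  obtain w where w: "lor w w = 1" "D = disk_of w"
    and tb: "\<And>c r. r > 0 \<Longrightarrow> tangent D (cball c r) \<Longrightarrow> lor w (quad_of c r) = -1"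
    and tg: "tangent D great_disk \<Longrightarrow> lor w great_quad = -1"
    using disk_quad[OF adjoin.hyps(7)] by blast
  have "lor w v = -1" if "window_quad v" "tangent D (disk_of v)" for v
    using that tg tb disk_of_great_quad disk_of_maximal_quad[of v] unfolding window_quad_def by metis
  then have wt: "lor w v1 = -1" "lor w v2 = -1" "lor w v3 = -1"
    using v adjoin.hyps unfolding D by blast+
  have wl: "w \<in> unit_lattice"
    by (rule descartes_lattice[OF l t w(1) wt])
  have "lor great_quad great_quad = 1" by simp
  then consider "maximal_quad v1" "maximal_quad v2" | "maximal_quad v1" "maximal_quad v3" | "maximal_quad v2" "maximal_quad v3"
    using v t unfolding window_quad_def by fastforce
  then have "window_quad w"
    using window_quad_step wl wt t by cases blast+
  then show ?case using w(2) by blast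
qed

section \<open>The disks touching the great circle\<close>

lemma nat_prod_eq_square:
  fixes a b h :: nat
  assumes "a * b = h\<^sup>2"
  obtains k p q where "coprime p q" "a = k * p\<^sup>2" "b = k * q\<^sup>2" "h = k * p * q"
proof (cases "gcd a b = 0")
  case True
  then show ?thesis using that[of 1 0 0] assms by simp
next
  case False
  define k where "k = gcd a b"
  have k: "k \<noteq> 0" using False by (simp add: k_def)
  obtain a' b' where ab: "a = a' * k" "b = b' * k" "coprime a' b'"
    using gcd_coprime_exists[OF False] unfolding k_def by blast
  have "k\<^sup>2 dvd h\<^sup>2"
    unfolding assms[symmetric] ab by (rule dvdI[of _ _ "a' * b'"]) (simp add: power2_eq_square)
  then have "k dvd h" by simp
  then obtain j where j: "h = k * j" by (auto elim: dvdE)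
  have "k\<^sup>2 * (a' * b') = k\<^sup>2 * j\<^sup>2"
    using assms unfolding ab j by (auto simp: power2_eq_square)
  then have "a' * b' = j\<^sup>2" using k by simp
  then have "is_nth_power 2 (a' * b')" by (auto simp: is_nth_power_def)
  then obtain p q where pq: "a' = p\<^sup>2" "b' = q\<^sup>2"
    using is_nth_power_mult_coprime_nat_iff[OF ab(3)] by (auto simp: is_nth_power_def)
  have "coprime p q" using ab(3) unfolding pq by simp
  moreover have "j\<^sup>2 = (p * q)\<^sup>2" using \<open>a' * b' = j\<^sup>2\<close> by (simp add: pq power_mult_distrib)
  then have "j = p * q" by simp
  ultimately show ?thesis using that[of p q k] ab j pq by simp
qed

lemma pythagorean_triple:
  fixes x y f :: int
  assumes "x\<^sup>2 + y\<^sup>2 = f\<^sup>2" "even y" "even (x + f)" "0 < f"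
  obtains k m n where "0 < k" "coprime m n"
    "x = k * (m\<^sup>2 - n\<^sup>2)" "y = k * (2 * m * n)" "f = k * (m\<^sup>2 + n\<^sup>2)"
proof -
  obtain h where h: "y = 2 * h" using assms(2) by (auto elim: evenE)
  obtain a where a: "x + f = 2 * a" using assms(3) by (rule evenE)
  define b where "b = f - a"
  have xf: "x = a - b" "f = a + b" using a by (simp_all add: b_def)
  have prod: "a * b = h\<^sup>2"
    using assms(1) unfolding h xf by (simp add: power2_eq_square algebra_simps)
  have "a \<ge> 0 \<and> b \<ge> 0"
  proof (rule ccontr)
    assume neg: "\<not> ?thesis"
    have "0 \<le> a * b" unfolding prod by simp
    then show False using neg assms(4) unfolding xf by (auto simp: zero_le_mult_iff)
  qed
  then have "nat a * nat b = (nat \<bar>h\<bar>)\<^sup>2"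
    using prod by (metis nat_mult_distrib nat_power_eq abs_ge_zero power2_abs)
  then obtain k p q where kpq: "coprime p q" "nat a = k * p\<^sup>2" "nat b = k * q\<^sup>2" "nat \<bar>h\<bar> = k * p * q"
    by (rule nat_prod_eq_square)
  define K m n where "K = int k" and "m = int p" and "n = (if h \<ge> 0 then int q else - int q)"
  have n2: "n\<^sup>2 = (int q)\<^sup>2" by (simp add: n_def)
  have a': "a = K * m\<^sup>2" "b = K * n\<^sup>2"
    using kpq(2,3) \<open>a \<ge> 0 \<and> b \<ge> 0\<close> unfolding n2 K_def m_def
    by (metis int_nat_eq of_nat_mult of_nat_power)+
  have "\<bar>h\<bar> = K * m * int q"
    using arg_cong[OF kpq(4), of int] by (simp add: K_def m_def)
  then have h': "h = K * m * n" by (auto simp: n_def abs_if split: if_splits)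
  have "K > 0" using assms(4) unfolding xf a' by (cases "K = 0") (auto simp: K_def)
  moreover have "coprime m n" using kpq(1) by (simp add: m_def n_def)
  ultimately show ?thesis
    by (rule that) (simp_all add: xf a' h h' algebra_simps)
qed

text \<open>The disk with centre \<open>w\<^sup>2 / (|w|\<^sup>2 + 1)\<close> and radius \<open>1 / (|w|\<^sup>2 + 1)\<close> for \<open>w = m + i n\<close>.\<close>

definition corona_quad :: "int \<Rightarrow> int \<Rightarrow> quad" where
  "corona_quad m n = (-1, of_int (m\<^sup>2 - n\<^sup>2), of_int (2 * m * n), of_int (m\<^sup>2 + n\<^sup>2))"

lemma corona_quad_unit_lattice: "corona_quad m n \<in> unit_lattice"
proof -
  have "(-1)\<^sup>2 + (m\<^sup>2 - n\<^sup>2)\<^sup>2 + (2 * m * n)\<^sup>2 - (m\<^sup>2 + n\<^sup>2)\<^sup>2 = 1"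
    by (simp add: power2_eq_square algebra_simps)
  moreover have "odd (- 1 :: int)" "even (2 * m * n)" "even (m\<^sup>2 - n\<^sup>2 + (m\<^sup>2 + n\<^sup>2))" by simp_all
  moreover have "corona_quad m n = (of_int (-1), of_int (m\<^sup>2 - n\<^sup>2), of_int (2 * m * n), of_int (m\<^sup>2 + n\<^sup>2))"
    by (simp add: corona_quad_def)
  ultimately show ?thesis unfolding unit_lattice_def by blast
qed

lemma curv_corona_quad: "curv (corona_quad m n) = (of_int m)\<^sup>2 + (of_int n)\<^sup>2 + 1"
  by (simp add: corona_quad_def)

lemma curv_corona_quad_pos: "curv (corona_quad m n) > 0"
  unfolding curv_corona_quad by (simp add: add_nonneg_pos)

lemma lor_corona_quad_great: "lor (corona_quad m n) great_quad = -1"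
  by (simp add: corona_quad_def)

lemma lor_corona_quad: "lor (corona_quad m n) (corona_quad p q) = 1 - 2 * of_int ((m * q - n * p)\<^sup>2)"
  by (simp add: corona_quad_def power2_eq_square algebra_simps)

lemma curv_corona_quad_ge_2:
  assumes "coprime m n"
  shows "curv (corona_quad m n) \<ge> 2"
proof -
  have "m \<noteq> 0 \<or> n \<noteq> 0" using assms by auto
  then have "m\<^sup>2 + n\<^sup>2 > 0" by (simp add: sum_power2_gt_zero_iff)
  then have "real_of_int (m\<^sup>2 + n\<^sup>2) \<ge> 1" by linarith
  then show ?thesis by (simp add: curv_corona_quad)
qed

lemma corona_quad_inner: "coprime m n \<Longrightarrow> corona_quad m n \<in> inner_quads"
  unfolding inner_quads_def
  using corona_quad_unit_lattice curv_corona_quad_ge_2 lor_corona_quad_great by simp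

lemma maximal_tangent_great:
  assumes "maximal_quad v" "lor v great_quad = -1"
  obtains m n where "coprime m n" "v = corona_quad m n"
proof -
  have v: "v \<in> inner_quads" using assms by (simp add: maximal_quad_def)
  obtain e x y f :: int where ve: "v = (of_int e, of_int x, of_int y, of_int f)"
    and par: "even y" "even (x + f)" and sq: "e\<^sup>2 + x\<^sup>2 + y\<^sup>2 - f\<^sup>2 = 1"
    using inner_quadsD(1)[OF v] unfolding unit_lattice_def by blast
  have "real_of_int e = -1" using assms(2) by (simp add: ve)
  then have e: "e = -1" by linarith
  have "curv v \<ge> 2" using v by (simp add: inner_quads_def)
  then have "f > 0" by (simp add: ve e)
  moreover have "x\<^sup>2 + y\<^sup>2 = f\<^sup>2" using sq by (simp add: e)
  ultimately obtain k m n where k: "0 < k" and mn: "coprime m n"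
    and xyf: "x = k * (m\<^sup>2 - n\<^sup>2)" "y = k * (2 * m * n)" "f = k * (m\<^sup>2 + n\<^sup>2)"
    using pythagorean_triple par by metis
  have "lor (corona_quad m n) v = 1"
    by (simp add: corona_quad_def ve e xyf power2_eq_square algebra_simps)
  moreover have "curv (corona_quad m n) \<le> curv v"
  proof -
    have "1 * (m\<^sup>2 + n\<^sup>2) \<le> k * (m\<^sup>2 + n\<^sup>2)" using k by (intro mult_right_mono) auto
    then have "m\<^sup>2 + n\<^sup>2 \<le> f" unfolding xyf by simp
    then have "real_of_int (m\<^sup>2 + n\<^sup>2) \<le> of_int f" by (rule of_int_le_iff[THEN iffD2])
    then show ?thesis by (simp add: curv_corona_quad ve e)
  qed
  ultimately have "nested (corona_quad m n) v" by (simp add: nested_def)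
  then have "corona_quad m n = v" using assms(1) corona_quad_inner[OF mn] by (simp add: maximal_quad_def)
  then show ?thesis using that mn by blast
qed

lemma tangent_corona_quads:
  assumes "\<bar>m * q - n * p\<bar> = 1"
  shows "tangent (disk_of (corona_quad m n)) (disk_of (corona_quad p q))"
proof -
  have "(m * q - n * p)\<^sup>2 = 1" using assms by (metis power2_abs one_power2)
  then have "lor (corona_quad m n) (corona_quad p q) = -1" unfolding lor_corona_quad by simp
  then have "dist (ctr (corona_quad m n)) (ctr (corona_quad p q)) = 1 / curv (corona_quad m n) + 1 / curv (corona_quad p q)"
    using lor_eq_iff_dist corona_quad_unit_lattice unit_lattice_lor curv_corona_quad_pos by blast
  then show ?thesis
    using tangent_ballsI curv_corona_quad_pos by (simp add: disk_of_curv)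
qed

lemma tangent_great_corona_quad:
  assumes "coprime m n"
  shows "tangent great_disk (disk_of (corona_quad m n))"
proof -
  define v where "v = corona_quad m n"
  define r where "r = 1 / curv v"
  have c: "curv v \<ge> 2" using curv_corona_quad_ge_2[OF assms] by (simp add: v_def)
  then have r: "0 < r" "r < 1" by (simp_all add: r_def)
  have "(norm (ctr v))\<^sup>2 = (1 - r)\<^sup>2"
    using norm_ctr[of v] unit_lattice_lor[OF corona_quad_unit_lattice, of m n] lor_corona_quad_great[of m n] c
    unfolding v_def[symmetric] r_def[symmetric] by (simp add: power2_eq_square algebra_simps)
  then have "norm (ctr v) = 1 - r" using r by simp
  then show ?thesis
    using tangent_great_disk_ballI[of "ctr v" r] r c unfolding v_def[symmetric] by (simp add: disk_of_curv r_def)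
qed

definition in_window :: "int \<Rightarrow> int \<Rightarrow> bool" where
  "in_window m n \<longleftrightarrow> disk_of (corona_quad m n) \<in> apollonian_window"

lemma in_window_uminus: "in_window (- m) (- n) = in_window m n"
  by (simp add: in_window_def corona_quad_def)

lemma is_disk_corona_quad: "is_disk (disk_of (corona_quad m n))"
  using disk_of_curv(1)[OF curv_corona_quad_pos[of m n]] curv_corona_quad_pos[of m n]
  unfolding is_disk_def by (metis zero_less_divide_1_iff)

lemma in_window_add:
  assumes "\<bar>m * q - n * p\<bar> = 1" "in_window m n" "in_window p q"
  shows "in_window (m + p) (n + q)"
proof -
  have det: "\<bar>(m + p) * n - (n + q) * m\<bar> = 1" "\<bar>(m + p) * q - (n + q) * p\<bar> = 1"
    using assms(1) by (simp_all add: algebra_simps abs_minus_commute)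
  have cop: "coprime a b" if "\<bar>a * d - b * c\<bar> = 1" for a b c d :: int
  proof (rule coprimeI)
    fix g assume "g dvd a" "g dvd b"
    then have "g dvd \<bar>a * d - b * c\<bar>" by simp
    then show "is_unit g" using that by simp
  qed
  have "coprime m n" "coprime (m + p) (n + q)" "coprime p q"
    using cop[OF assms(1)] cop[OF det(1)] cop[of p n q m] assms(1)
    by (simp_all add: algebra_simps abs_minus_commute)
  note t = this[THEN tangent_great_corona_quad]
  show ?thesis
    unfolding in_window_def apollonian_window_def
  proof (rule apollonian_packing.adjoin)
    show "great_disk \<in> apollonian_packing {great_disk, cball (1/2) (1/2), cball (-1/2) (1/2)}"
      by (rule apollonian_packing.seed) simp
    show "disk_of (corona_quad m n) \<in> apollonian_packing {great_disk, cball (1/2) (1/2), cball (-1/2) (1/2)}"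
      "disk_of (corona_quad p q) \<in> apollonian_packing {great_disk, cball (1/2) (1/2), cball (-1/2) (1/2)}"
      using assms(2,3) by (simp_all only: in_window_def apollonian_window_def)
    show "tangent (disk_of (corona_quad (m + p) (n + q))) great_disk"
      using t(2) by (simp only: tangent_commute)
  qed (use t tangent_corona_quads assms(1) det is_disk_corona_quad in blast)+
qed

lemma coprime_diff_mult: "coprime (m - s * n) n" if "coprime m n" for m n s :: int
proof (rule coprimeI)
  fix g assume g: "g dvd m - s * n" "g dvd n"
  then have "g dvd (m - s * n) + s * n" by (intro dvd_add dvd_mult)
  then have "g dvd m" by simp
  then show "is_unit g" using coprime_common_divisor[OF that] g(2) by blast
qed

text \<open>
  Euclid's algorithm on the coefficients: subtracting \<open>s * n\<close> from \<open>m\<close> is compensated by the change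
  of basis \<open>v \<mapsto> v + s * u\<close>.
\<close>

lemma in_window_combination:
  assumes "\<bar>u1 * v2 - u2 * v1\<bar> = 1" "in_window u1 u2" "in_window v1 v2" "coprime m n"
  shows "in_window (m * u1 + n * v1) (m * u2 + n * v2)"
  using assms
proof (induction "nat (\<bar>m\<bar> + \<bar>n\<bar>)" arbitrary: m n u1 u2 v1 v2 rule: less_induct)
  case less
  have minus: "in_window (s * a) (s * b)" if "in_window a b" "s = 1 \<or> s = -1" for s a b
    using that in_window_uminus by auto
  consider "n = 0" | "m = 0" | "m \<noteq> 0" "n \<noteq> 0" "\<bar>n\<bar> \<le> \<bar>m\<bar>" | "m \<noteq> 0" "n \<noteq> 0" "\<bar>m\<bar> < \<bar>n\<bar>"
    by linarith
  then show ?case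
  proof cases
    case 1
    then have "m = 1 \<or> m = -1" using less.prems(4) by auto
    then show ?thesis using minus[OF less.prems(2)] 1 by simp
  next
    case 2
    then have "n = 1 \<or> n = -1" using less.prems(4) by auto
    then show ?thesis using minus[OF less.prems(3)] 2 by simp
  next
    case 3
    define s where "s = sgn m * sgn n"
    have s: "s = 1 \<or> s = -1" using 3 by (auto simp: s_def sgn_if)
    have "\<bar>m - s * n\<bar> < \<bar>m\<bar>" using 3 by (auto simp: s_def sgn_if)
    then have "nat (\<bar>m - s * n\<bar> + \<bar>n\<bar>) < nat (\<bar>m\<bar> + \<bar>n\<bar>)" by simp
    moreover have "\<bar>u1 * (v2 + s * u2) - u2 * (v1 + s * u1)\<bar> = 1"
      using less.prems(1) by (simp add: algebra_simps)
    moreover have "in_window (v1 + s * u1) (v2 + s * u2)"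
      using s less.prems(1) by (intro in_window_add less.prems(3) minus[OF less.prems(2)]) (auto simp: algebra_simps abs_minus_commute)
    moreover have "coprime (m - s * n) n"
      using coprime_diff_mult less.prems(4) coprime_commute by blast
    ultimately have "in_window ((m - s * n) * u1 + n * (v1 + s * u1)) ((m - s * n) * u2 + n * (v2 + s * u2))"
      using less.hyps less.prems(2) by blast
    then show ?thesis by (simp add: algebra_simps)
  next
    case 4
    define s where "s = sgn m * sgn n"
    have s: "s = 1 \<or> s = -1" using 4 by (auto simp: s_def sgn_if)
    have "\<bar>n - s * m\<bar> < \<bar>n\<bar>" using 4 by (auto simp: s_def sgn_if)
    then have "nat (\<bar>m\<bar> + \<bar>n - s * m\<bar>) < nat (\<bar>m\<bar> + \<bar>n\<bar>)" by simp
    moreover have "\<bar>(u1 + s * v1) * v2 - (u2 + s * v2) * v1\<bar> = 1"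
      using less.prems(1) by (simp add: algebra_simps)
    moreover have "in_window (u1 + s * v1) (u2 + s * v2)"
      using s less.prems(1) by (intro in_window_add less.prems(2) minus[OF less.prems(3)]) (auto simp: algebra_simps abs_minus_commute)
    moreover have "coprime m (n - s * m)"
      using coprime_diff_mult less.prems(4) coprime_commute by blast
    ultimately have "in_window (m * (u1 + s * v1) + (n - s * m) * v1) (m * (u2 + s * v2) + (n - s * m) * v2)"
      using less.hyps less.prems(3) by blast
    then show ?thesis by (simp add: algebra_simps)
  qed
qed

lemma coprime_in_window:
  assumes "coprime m n"
  shows "in_window m n"
proof -
  have "corona_quad 1 0 = (-1, 1, 0, 1)" "corona_quad 0 1 = (-1, -1, 0, 1)"
    by (simp_all add: corona_quad_def)
  then have "in_window 1 0" "in_window 0 1"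
    unfolding in_window_def apollonian_window_def
    by (simp_all only: disk_of_seeds) (auto intro: apollonian_packing.seed)
  then show ?thesis using in_window_combination[of 1 1 0 0 m n] assms by simp
qed

lemma corona_window_eq:
  "corona apollonian_window great_disk = (\<lambda>(m, n). disk_of (corona_quad m n)) ` {(m, n). gcd m n = 1}"
proof (intro equalityI subsetI)
  fix D assume "D \<in> corona apollonian_window great_disk"
  then have D: "D \<in> apollonian_window" "tangent great_disk D" by (auto simp: corona_def)
  obtain v where v: "window_quad v" "D = disk_of v" using packing_window_quad[OF D(1)] by blast
  have g: "window_quad great_quad" by (simp add: window_quad_def)
  have "tangent (disk_of great_quad) (disk_of v)" using D(2) v(2) disk_of_great_quad by metis
  then have lv: "lor v great_quad = -1"
    using tangent_window_quads[OF g v(1)] lor_commute by metis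
  then have "v \<noteq> great_quad" by auto
  then have "maximal_quad v" using v(1) by (simp add: window_quad_def)
  then obtain m n where "coprime m n" "v = corona_quad m n"
    using maximal_tangent_great lv by blast
  then show "D \<in> (\<lambda>(m, n). disk_of (corona_quad m n)) ` {(m, n). gcd m n = 1}"
    unfolding v(2) by (intro image_eqI[of _ _ "(m, n)"]) (auto simp del: disk_of.simps)
next
  fix D assume "D \<in> (\<lambda>(m, n). disk_of (corona_quad m n)) ` {(m, n). gcd m n = (1::int)}"
  then obtain m n :: int where "coprime m n" "D = disk_of (corona_quad m n)"
    by (auto simp: coprime_iff_gcd_eq_1 simp del: disk_of.simps)
  then show "D \<in> corona apollonian_window great_disk"
    using coprime_in_window tangent_great_corona_quad by (auto simp: corona_def in_window_def simp del: disk_of.simps)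
qed

section \<open>The total area\<close>

lemma summable_on_inverse_square_plus_one_int: "(\<lambda>n :: int. 1 / ((real_of_int n)\<^sup>2 + 1)) summable_on UNIV"
proof -
  let ?h = "\<lambda>n :: int. 1 / ((real_of_int n)\<^sup>2 + 1)"
  have "summable (\<lambda>n. 1 / ((real n)\<^sup>2 + 1))"
  proof (rule summable_comparison_test)
    show "summable (\<lambda>n. inverse (real n ^ 2))" by (rule inverse_power_summable) simp
    have "1 / ((real n)\<^sup>2 + 1) \<le> inverse ((real n)\<^sup>2)" if "1 \<le> n" for n
      using le_imp_inverse_le[of "(real n)\<^sup>2" "(real n)\<^sup>2 + 1"] that by (simp add: inverse_eq_divide)
    then show "\<exists>N. \<forall>n\<ge>N. norm (1 / ((real n)\<^sup>2 + 1)) \<le> inverse (real n ^ 2)" by auto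
  qed
  then have *: "(\<lambda>n. 1 / ((real n)\<^sup>2 + 1)) summable_on UNIV"
    by (subst summable_on_UNIV_nonneg_real_iff) auto
  have "?h summable_on (range int)"
    using * by (subst summable_on_reindex) (auto simp: o_def)
  moreover have "?h summable_on (range (\<lambda>n. - int n))"
    using * by (subst summable_on_reindex) (auto simp: o_def inj_on_def)
  ultimately have "?h summable_on (range int \<union> range (\<lambda>n. - int n))"
    by (rule summable_on_union)
  moreover have "z \<in> range int \<union> range (\<lambda>n. - int n)" for z
    by (cases z rule: int_cases2) auto
  then have "range int \<union> range (\<lambda>n. - int n) = UNIV" by blast
  ultimately show ?thesis by simp
qed

lemma summable_on_inverse_corona_curv_square:
  "(\<lambda>(m :: int, n :: int). 1 / ((real_of_int m)\<^sup>2 + (real_of_int n)\<^sup>2 + 1)\<^sup>2) summable_on UNIV"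
proof -
  let ?h = "\<lambda>n :: int. 1 / ((real_of_int n)\<^sup>2 + 1)"
  have prod: "(\<lambda>(m, n). ?h m * ?h n) summable_on (UNIV \<times> UNIV)"
  proof (rule summable_on_SigmaI)
    show "((\<lambda>n. case (m, n) of (m, n) \<Rightarrow> ?h m * ?h n) has_sum ?h m * infsum ?h UNIV) UNIV" for m
      unfolding prod.case by (intro has_sum_cmult_right has_sum_infsum summable_on_inverse_square_plus_one_int)
    show "(\<lambda>m. ?h m * infsum ?h UNIV) summable_on UNIV"
      by (intro summable_on_cmult_left summable_on_inverse_square_plus_one_int)
  qed simp
  have bound: "1 / (a\<^sup>2 + b\<^sup>2 + 1)\<^sup>2 \<le> (1 / (a\<^sup>2 + 1)) * (1 / (b\<^sup>2 + 1))" for a b :: real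
  proof -
    have pos: "0 < (a\<^sup>2 + 1) * (b\<^sup>2 + 1)" by (intro mult_pos_pos add_nonneg_pos) auto
    have "(a\<^sup>2 + b\<^sup>2 + 1)\<^sup>2 = (a\<^sup>2 + 1) * (b\<^sup>2 + 1) + (a^4 + b^4 + a\<^sup>2 * b\<^sup>2 + a\<^sup>2 + b\<^sup>2)"
      by algebra
    moreover have "0 \<le> a^4 + b^4 + a\<^sup>2 * b\<^sup>2 + a\<^sup>2 + b\<^sup>2" by simp
    ultimately have "(a\<^sup>2 + 1) * (b\<^sup>2 + 1) \<le> (a\<^sup>2 + b\<^sup>2 + 1)\<^sup>2" by linarith
    from le_imp_inverse_le[OF this pos] show ?thesis by (simp add: inverse_eq_divide)
  qed
  show ?thesis
    using prod unfolding UNIV_Times_UNIV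
  proof (rule summable_on_comparison_test)
    fix z :: "int \<times> int"
    show "(case z of (m, n) \<Rightarrow> 1 / ((real_of_int m)\<^sup>2 + (real_of_int n)\<^sup>2 + 1)\<^sup>2) \<le> (case z of (m, n) \<Rightarrow> ?h m * ?h n)"
      unfolding case_prod_beta by (rule bound)
    show "0 \<le> (case z of (m, n) \<Rightarrow> 1 / ((real_of_int m)\<^sup>2 + (real_of_int n)\<^sup>2 + 1)\<^sup>2)"
      unfolding case_prod_beta by simp
  qed
qed

lemma measure_corona_quad:
  "measure lebesgue (disk_of (corona_quad m n)) = pi * (1 / ((real_of_int m)\<^sup>2 + (real_of_int n)\<^sup>2 + 1)\<^sup>2)"
proof -
  have "measure lebesgue (cball c r) = pi * r\<^sup>2" if "r \<ge> 0" for c :: complex and r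
    using content_cball[OF that, of c] by (simp add: unit_ball_vol_2)
  then show ?thesis
    using curv_corona_quad_pos[of m n] unfolding disk_of_curv(1)[OF curv_corona_quad_pos]
    by (simp add: curv_corona_quad power_divide)
qed

lemma disk_of_corona_quad_eqD:
  assumes "disk_of (corona_quad m n) = disk_of (corona_quad p q)"
  shows "(p, q) = (m, n) \<or> (p, q) = (- m, - n)"
proof -
  define u v where "u = corona_quad m n" and "v = corona_quad p q"
  have pos: "curv u > 0" "curv v > 0" and unit: "lor u u = 1" "lor v v = 1"
    using curv_corona_quad_pos unit_lattice_lor[OF corona_quad_unit_lattice] by (auto simp: u_def v_def)
  have "cball (ctr u) (1 / curv u) = cball (ctr v) (1 / curv v)"
    using assms pos by (simp add: u_def[symmetric] v_def[symmetric] disk_of_curv)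
  then have "ctr u = ctr v" "1 / curv u = 1 / curv v"
    using pos unfolding cball_eq_cball_iff by (auto simp: not_less[symmetric])
  then have "quad_of (ctr u) (1 / curv u) = quad_of (ctr v) (1 / curv v)" by simp
  then have "u = v" using quad_of_ctr[OF unit(1)] quad_of_ctr[OF unit(2)] pos by simp
  then have "real_of_int (m\<^sup>2 - n\<^sup>2) = of_int (p\<^sup>2 - q\<^sup>2)" "real_of_int (2 * m * n) = of_int (2 * p * q)"
    "real_of_int (m\<^sup>2 + n\<^sup>2) = of_int (p\<^sup>2 + q\<^sup>2)"
    unfolding u_def v_def corona_quad_def prod.inject by blast+
  then have eq: "m\<^sup>2 - n\<^sup>2 = p\<^sup>2 - q\<^sup>2" "m * n = p * q" "m\<^sup>2 + n\<^sup>2 = p\<^sup>2 + q\<^sup>2"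
    unfolding of_int_eq_iff by simp_all
  then have "p\<^sup>2 = m\<^sup>2" "q\<^sup>2 = n\<^sup>2" by linarith+
  then have "p = m \<or> p = - m" "q = n \<or> q = - n" by (simp_all add: power2_eq_iff)
  then show ?thesis using eq(2) by auto
qed

theorem proposition3p2:
  "((\<lambda>D. measure lebesgue D) has_sum
     (pi / 2 * (\<Sum>\<^sub>\<infinity>(m, n)\<in>{(m :: int, n :: int). gcd m n = 1}.
        1 / ((real_of_int m)\<^sup>2 + (real_of_int n)\<^sup>2 + 1)\<^sup>2)))
   (corona apollonian_window great_disk)"
proof -
  define g where "g = (\<lambda>(m :: int, n :: int). 1 / ((real_of_int m)\<^sup>2 + (real_of_int n)\<^sup>2 + 1)\<^sup>2)"
  define S where "S = {(m :: int, n :: int). gcd m n = 1}"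
  define H where "H = {(m, n) \<in> S. 0 < m \<or> m = 0 \<and> 0 < n}"
  define d where "d = (\<lambda>(m, n). disk_of (corona_quad m n))"
  have S: "S = H \<union> uminus ` H"
  proof (intro equalityI subsetI)
    fix z assume z: "z \<in> S"
    obtain m n where mn: "z = (m, n)" by (cases z)
    have "m \<noteq> 0 \<or> n \<noteq> 0" using z by (auto simp: S_def mn)
    then have "z \<in> H \<or> - z \<in> H" using z by (auto simp: H_def S_def mn)
    then show "z \<in> H \<union> uminus ` H" by (metis UnI1 UnI2 image_eqI minus_minus)
  qed (auto simp: H_def S_def)
  have disj: "H \<inter> uminus ` H = {}" by (auto simp: H_def)
  have inj: "inj_on uminus H" by (simp add: inj_on_def)
  have "g summable_on UNIV" unfolding g_def by (rule summable_on_inverse_corona_curv_square)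
  then have "g summable_on H" by (rule summable_on_subset) simp
  then have H: "(g has_sum infsum g H) H" by (rule has_sum_infsum)
  moreover have "g \<circ> uminus = g" by (auto simp: g_def)
  ultimately have "(g has_sum infsum g H) (uminus ` H)" using has_sum_reindex[OF inj, of g] by simp
  then have "(g has_sum (infsum g H + infsum g H)) S"
    unfolding S using H disj by (intro has_sum_Un_disjoint)
  then have sum: "infsum g S = 2 * infsum g H" by (simp add: infsumI)
  have "d ` S = d ` H"
  proof -
    have "d (- z) = d z" for z
      by (cases z) (simp add: d_def corona_quad_def)
    then show ?thesis unfolding S by (simp add: image_Un image_image)
  qed
  then have corona: "corona apollonian_window great_disk = d ` H"
    unfolding corona_window_eq d_def S_def by simp
  have "inj_on d H"
  proof (rule inj_onI)
    fix z w assume zw: "z \<in> H" "w \<in> H" "d z = d w"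
    then have "w = z \<or> w = - z"
      using disk_of_corona_quad_eqD by (cases z; cases w) (simp add: d_def del: disk_of.simps)
    then show "z = w" using zw disj by blast
  qed
  moreover have "((\<lambda>z. pi * g z) has_sum (pi * infsum g H)) H"
    using H by (rule has_sum_cmult_right)
  moreover have "measure lebesgue \<circ> d = (\<lambda>z. pi * g z)"
    by (auto simp: d_def g_def measure_corona_quad simp del: disk_of.simps)
  ultimately have "(measure lebesgue has_sum (pi * infsum g H)) (d ` H)"
    using has_sum_reindex[of d H "measure lebesgue"] by simp
  moreover have "pi * infsum g H = pi / 2 * infsum g S" unfolding sum by simp
  ultimately show ?thesis unfolding corona g_def S_def by simp
qed

end
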